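(* Let $\alpha>-1$ and let $\Phi,\Psi:\mathbb{D}\to\mathbb{D}$ be analytic. Consider the composition operators $C_\Phi$ and $C_\Psi$ on the weighted Bergman space $\mathcal{A}_\alpha^2(\mathbb{D})$. Then the product $C_\Phi^*C_\Psi$ is an isometry if and only if $\Phi$ and $\Psi$ are rotations on $\mathbb{D}$.
   Context: $\mathbb{D}=\{z\in\mathbb{C}:|z|<1\}$. For $\alpha>-1$, $\mathcal{A}_\alpha^2(\mathbb{D})$ is the Hilbert space of analytic functions $f:\mathbb{D}\to\mathbb{C}$ with $\|f\|_\alpha^2=\int_{\mathbb{D}}|f(z)|^2\,dA_\alpha(z)<\infty$, where $dA_\alpha(z)=(\alpha+1)(1-|z|^2)^\alpha\,dA(z)$ and $dA$ is area measure on $\mathbb{D}$ normalized so that $\mathbb{D}$ has measure $1$; the inner product is $\langle f,g\rangle=\int_{\mathbb{D}}f\overline{g}\,dA_\alpha$. For an analytic self-map $\Phi$ of $\mathbb{D}$, the composition operator is $C_\Phi f=f\circ\Phi$; it is a bounded operator on $\mathcal{A}_\alpha^2(\mathbb{D})$, and $C_\Phi^*$ denotes its Hilbert space adjoint. An operator $T$ is an isometry if $\|Tf\|_\alpha=\|f\|_\alpha$ for all $f$ (equivalently $T^*T=I$; surjectivity is not required). A rotation is a map $z\mapsto\lambda z$ on $\mathbb{D}$ with $\lambda\in\mathbb{C}$, $|\lambda|=1$. *)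

theory Defs
  imports "HOL-Complex_Analysis.Complex_Analysis"
begin

abbreviation unit_disc :: "complex set" where
  "unit_disc \<equiv> ball 0 1"

text \<open>The measure \<open>dA\<^sub>\<alpha>\<close>: the density is taken with respect to Lebesgue measure on the disc
  normalised to total mass \<open>1\<close>; the complement of the disc is a null set.\<close>

definition bergman_measure :: "real \<Rightarrow> complex measure" where
  "bergman_measure \<alpha> =
     density (uniform_measure lborel unit_disc)
       (\<lambda>z. ennreal ((\<alpha> + 1) * (1 - (norm z)\<^sup>2) powr \<alpha>))"

text \<open>A function on the disc is represented by its extension by \<open>0\<close> to the whole plane, so that
  equality of elements of the space is equality of HOL functions.\<close>

definition bergman_space :: "real \<Rightarrow> (complex \<Rightarrow> complex) set" where
  "bergman_space \<alpha> =
     {f. f holomorphic_on unit_disc \<and> (\<forall>z. z \<notin> unit_disc \<longrightarrow> f z = 0) \<and>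
         integrable (bergman_measure \<alpha>) (\<lambda>z. (norm (f z))\<^sup>2)}"

definition bergman_inner :: "real \<Rightarrow> (complex \<Rightarrow> complex) \<Rightarrow> (complex \<Rightarrow> complex) \<Rightarrow> complex" where
  "bergman_inner \<alpha> f g = (LINT z|bergman_measure \<alpha>. f z * cnj (g z))"

definition bergman_norm :: "real \<Rightarrow> (complex \<Rightarrow> complex) \<Rightarrow> real" where
  "bergman_norm \<alpha> f = sqrt (LINT z|bergman_measure \<alpha>. (norm (f z))\<^sup>2)"

definition composition_operator ::
    "(complex \<Rightarrow> complex) \<Rightarrow> (complex \<Rightarrow> complex) \<Rightarrow> (complex \<Rightarrow> complex)" where
  "composition_operator \<Phi> f = (\<lambda>z. if z \<in> unit_disc then f (\<Phi> z) else 0)"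

text \<open>The Hilbert space adjoint. For a bounded operator \<open>T\<close> on the space, the element described
  here exists by the Riesz representation theorem and is unique.\<close>

definition bergman_adjoint ::
    "real \<Rightarrow> ((complex \<Rightarrow> complex) \<Rightarrow> (complex \<Rightarrow> complex)) \<Rightarrow>
     (complex \<Rightarrow> complex) \<Rightarrow> (complex \<Rightarrow> complex)" where
  "bergman_adjoint \<alpha> T g =
     (THE h. h \<in> bergman_space \<alpha> \<and>
        (\<forall>f \<in> bergman_space \<alpha>. bergman_inner \<alpha> (T f) g = bergman_inner \<alpha> f h))"

definition bergman_isometry ::
    "real \<Rightarrow> ((complex \<Rightarrow> complex) \<Rightarrow> (complex \<Rightarrow> complex)) \<Rightarrow> bool" where
  "bergman_isometry \<alpha> T \<longleftrightarrow>
     (\<forall>f \<in> bergman_space \<alpha>. T f \<in> bergman_space \<alpha> \<and> bergman_norm \<alpha> (T f) = bergman_norm \<alpha> f)"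

definition disc_rotation :: "(complex \<Rightarrow> complex) \<Rightarrow> bool" where
  "disc_rotation \<Phi> \<longleftrightarrow> (\<exists>\<mu>. norm \<mu> = 1 \<and> (\<forall>z \<in> unit_disc. \<Phi> z = \<mu> * z))"

end

theory Submission
  imports Defs "HOL-Probability.Distribution_Functions"
begin

text \<open>
  Write \<open>T = C\<^sub>\<Phi>\<^sup>* C\<^sub>\<Psi>\<close> and suppose that \<open>T\<close> is an isometry. Since \<open>\<langle>1, T 1\<rangle> = 1 = \<parallel>1\<parallel>\<^sup>2 = \<parallel>T 1\<parallel>\<^sup>2\<close>,
  we get \<open>T 1 = 1\<close>, and pairing with \<open>z\<close> yields \<open>\<Phi> 0 = 0\<close>. On the other hand
  \<open>|\<langle>1, T f\<rangle>| = |f (\<Psi> 0)|\<close> is at most \<open>\<parallel>f\<parallel>\<close>, and \<open>f = 1 + cnj (\<Psi> 0) z\<close> shows \<open>\<Psi> 0 = 0\<close>. Now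
  \<open>C\<^sub>\<Phi>\<close> is a contraction by Littlewood's subordination principle, so \<open>\<parallel>z\<parallel> = \<parallel>T z\<parallel> \<le> \<parallel>\<Psi>\<parallel>\<close>, and
  equality in Schwarz' lemma makes \<open>\<Psi>\<close> a rotation. Then \<open>C\<^sub>\<Psi>\<close> is onto, so
  \<open>g = C\<^sub>\<Phi>\<^sup>* z\<close> has norm \<open>\<parallel>z\<parallel>\<close>, which forces \<open>g \<circ> \<Phi> = z\<close>; as \<open>|g' 0| \<le> 1\<close>, the chain rule gives \<open>|\<Phi>' 0| = 1\<close> and
  \<open>\<Phi>\<close> is a rotation too.

  The adjoint is obtained from coefficients with respect to the orthogonal family of monomials;
  boundedness of \<open>C\<^sub>\<Phi>\<close> for arbitrary \<open>\<Phi>\<close> reduces to \<open>\<Phi> 0 = 0\<close> by composing with a Moebius map.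
\<close>

section \<open>Change of variables in the complex plane\<close>

text \<open>Moves integrability between \<open>complex\<close> and \<open>real^2\<close>: each
  direction applies a bounded linear map, the way back being the left inverse
  \<open>S\<close>.\<close>

lemma integrable_bounded_linear_left_inverse:
  fixes T :: "'a::{banach,second_countable_topology} \<Rightarrow> 'b::{banach,second_countable_topology}"
  assumes T: "bounded_linear T" and S: "bounded_linear S" and ST: "\<And>x. S (T x) = x"
  shows "integrable M (\<lambda>x. T (f x)) \<longleftrightarrow> integrable M f"
  using integrable_bounded_linear[OF T, of M f] integrable_bounded_linear[OF S, of M "\<lambda>x. T (f x)"]
  by (auto simp: ST)

text \<open>Coordinates in \<open>real^2\<close> are used because the Jacobian change of variables
  theorem speaks about \<open>real^'n\<close> and determinants of matrices.\<close>

definition vec_of_complex :: "complex \<Rightarrow> real^2" where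
  "vec_of_complex z = vector [Re z, Im z]"

definition complex_of_vec :: "real^2 \<Rightarrow> complex" where
  "complex_of_vec v = Complex (vec_nth v 1) (vec_nth v 2)"

lemma complex_of_vec_of_complex [simp]: "complex_of_vec (vec_of_complex z) = z"
  by (simp add: complex_of_vec_def vec_of_complex_def vector_def)

lemma vec_of_complex_of_vec [simp]: "vec_of_complex (complex_of_vec v) = v"
  by (simp add: complex_of_vec_def vec_of_complex_def vec_eq_iff forall_2)

lemma bounded_linear_vec_of_complex: "bounded_linear vec_of_complex"
  by (rule linear_conv_bounded_linear[THEN iffD1], rule linearI)
     (simp_all add: vec_of_complex_def vec_eq_iff forall_2)

lemma bounded_linear_complex_of_vec: "bounded_linear complex_of_vec"
  by (rule linear_conv_bounded_linear[THEN iffD1], rule linearI)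
     (simp_all add: complex_of_vec_def complex_eq_iff)

lemma measurable_vec_of_complex [measurable]: "vec_of_complex \<in> borel \<rightarrow>\<^sub>M borel"
  by (intro borel_measurable_continuous_onI linear_continuous_on bounded_linear_vec_of_complex)

lemma measurable_complex_of_vec [measurable]: "complex_of_vec \<in> borel \<rightarrow>\<^sub>M borel"
  by (intro borel_measurable_continuous_onI linear_continuous_on bounded_linear_complex_of_vec)

text \<open>Lebesgue measure is determined by its values on boxes, and the preimage of a complex box
  is a box in \<open>real^2\<close> with the same side lengths.\<close>

lemma lborel_distr_complex_of_vec: "distr lborel borel complex_of_vec = (lborel :: complex measure)"
proof (rule lborel_eqI[symmetric])
  fix l u :: complex
  assume le: "\<And>b. b \<in> Basis \<Longrightarrow> l \<bullet> b \<le> u \<bullet> b"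
  have l: "Re l \<le> Re u" "Im l \<le> Im u"
    using le[of 1] le[of \<i>] by (auto simp: Basis_complex_def)
  have "emeasure (distr lborel borel complex_of_vec) (box l u) =
        emeasure lborel (complex_of_vec -` box l u)"
    by (subst emeasure_distr) auto
  also have "complex_of_vec -` box l u = box (vec_of_complex l) (vec_of_complex u)"
    by (auto simp: complex_of_vec_def vec_of_complex_def interval_cbox_cart mem_box_cart in_box_complex_iff forall_2)
  also have "emeasure lborel \<dots> = ennreal (\<Prod>b\<in>Basis. (vec_of_complex u - vec_of_complex l) \<bullet> b)"
    using l by (intro emeasure_lborel_box)
      (auto simp: vec_of_complex_def Basis_vec_def inner_axis UNIV_2)
  also have "(\<Prod>b\<in>Basis. (vec_of_complex u - vec_of_complex l) \<bullet> b) = (\<Prod>b\<in>Basis. (u - l) \<bullet> b)"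
  proof -
    have B: "(Basis :: (real^2) set) = {axis 1 1, axis 2 1}"
      by (auto simp: Basis_vec_def exhaust_2 UNIV_2)
    have "axis 1 1 \<noteq> (axis 2 1 :: real^2)"
      by (simp add: axis_eq_axis)
    then have "(\<Prod>b\<in>Basis. (vec_of_complex u - vec_of_complex l) \<bullet> b) =
        (vec_of_complex u - vec_of_complex l) \<bullet> axis 1 1 * ((vec_of_complex u - vec_of_complex l) \<bullet> axis 2 1)"
      unfolding B by simp
    then show ?thesis
      by (simp add: Basis_complex_def inner_axis vec_of_complex_def)
  qed
  finally show "emeasure (distr lborel borel complex_of_vec) (box l u) =
     ennreal (\<Prod>b\<in>Basis. (u - l) \<bullet> b)" .
qed simp

text \<open>Multiplication by c = x + iy has the matrix with rows (x, -y) and (y, x). Hence a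
  complex derivative c contributes the Jacobian factor |c|^2.\<close>

lemma det_complex_mult:
  "\<bar>det (matrix (\<lambda>h. vec_of_complex (c * complex_of_vec h)))\<bar> = (norm c)\<^sup>2"
  by (simp add: det_2 matrix_def vec_of_complex_def complex_of_vec_def axis_def cmod_power2
        algebra_simps flip: power2_eq_square)

text \<open>Bridge between integrals over subsets of \<open>real^2\<close>, as in the change of
  variables theorem, and Bochner integrals over the plane with an indicator. Borel measurability
  allows replacing \<open>lebesgue\<close> by \<open>lborel\<close>.\<close>

lemma integral_vec_of_complex:
  fixes G :: "complex \<Rightarrow> complex"
  assumes [measurable]: "(\<lambda>z. indicator A z *\<^sub>R G z) \<in> borel_measurable borel"
  shows "(\<lambda>x. vec_of_complex (G (complex_of_vec x))) absolutely_integrable_on (complex_of_vec -` A)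
           \<longleftrightarrow> integrable lborel (\<lambda>z. indicator A z *\<^sub>R G z)" (is "?abs \<longleftrightarrow> ?int")
    and "integrable lborel (\<lambda>z. indicator A z *\<^sub>R G z) \<Longrightarrow>
         integral (complex_of_vec -` A) (\<lambda>x. vec_of_complex (G (complex_of_vec x)))
           = vec_of_complex (LINT z|lborel. indicator A z *\<^sub>R G z)"
proof -
  define H where "H = (\<lambda>z. indicator A z *\<^sub>R G z)"
  have [measurable]: "H \<in> borel_measurable borel" unfolding H_def by fact
  have ind: "(\<lambda>x. indicator (complex_of_vec -` A) x *\<^sub>R vec_of_complex (G (complex_of_vec x))) =
        (\<lambda>x. vec_of_complex (H (complex_of_vec x)))"
    by (auto simp: H_def indicator_def linear_0[OF bounded_linear.linear[OF bounded_linear_vec_of_complex]])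
  have "?abs \<longleftrightarrow> integrable lborel (\<lambda>x. vec_of_complex (H (complex_of_vec x)))"
    unfolding set_integrable_def ind by (rule integrable_completion) measurable
  also have "\<dots> \<longleftrightarrow> integrable lborel (\<lambda>x. H (complex_of_vec x))"
    by (rule integrable_bounded_linear_left_inverse[OF bounded_linear_vec_of_complex
          bounded_linear_complex_of_vec]) simp
  also have "\<dots> \<longleftrightarrow> integrable (distr lborel borel complex_of_vec) H"
    by (rule integrable_distr_eq[symmetric]) auto
  finally show eq: "?abs \<longleftrightarrow> ?int"
    unfolding lborel_distr_complex_of_vec H_def .
  assume i: ?int
  then have abs: ?abs using eq by simp
  have i': "integrable lborel (\<lambda>x. H (complex_of_vec x))"
    using i unfolding H_def[symmetric] lborel_distr_complex_of_vec[symmetric]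
    by (subst (asm) integrable_distr_eq) auto
  have "integral (complex_of_vec -` A) (\<lambda>x. vec_of_complex (G (complex_of_vec x))) =
        (LINT x|lebesgue. vec_of_complex (H (complex_of_vec x)))"
    using set_lebesgue_integral_eq_integral(2)[OF abs] unfolding set_lebesgue_integral_def ind by simp
  also have "\<dots> = (LINT x|lborel. vec_of_complex (H (complex_of_vec x)))"
    by (rule integral_completion) measurable
  also have "\<dots> = vec_of_complex (LINT x|lborel. H (complex_of_vec x))"
    by (rule integral_bounded_linear[OF bounded_linear_vec_of_complex i'])
  also have "(LINT x|lborel. H (complex_of_vec x)) = (LINT z|distr lborel borel complex_of_vec. H z)"
    by (rule integral_distr[symmetric]) auto
  finally show "integral (complex_of_vec -` A) (\<lambda>x. vec_of_complex (G (complex_of_vec x)))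
           = vec_of_complex (LINT z|lborel. indicator A z *\<^sub>R G z)"
    unfolding lborel_distr_complex_of_vec H_def .
qed

text \<open>The real theorem is applied to the map \<open>g\<close> that is \<phi> in coordinates,
  with Jacobian |\<phi>'|^2. The measurability assumptions carry indicators, so they constrain the
  integrands only on the sets integrated over.\<close>

lemma complex_change_of_variables:
  fixes F \<phi> \<phi>' :: "complex \<Rightarrow> complex"
  assumes S: "S \<in> sets borel"
    and der: "\<And>z. z \<in> S \<Longrightarrow> (\<phi> has_field_derivative \<phi>' z) (at z)"
    and inj: "inj_on \<phi> S"
    and m1: "(\<lambda>w. indicator (\<phi> ` S) w *\<^sub>R F w) \<in> borel_measurable borel"
    and m2: "(\<lambda>z. indicator S z *\<^sub>R ((norm (\<phi>' z))\<^sup>2 *\<^sub>R F (\<phi> z))) \<in> borel_measurable borel"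
    and int: "integrable lborel (\<lambda>w. indicator (\<phi> ` S) w *\<^sub>R F w)"
  shows "integrable lborel (\<lambda>z. indicator S z *\<^sub>R ((norm (\<phi>' z))\<^sup>2 *\<^sub>R F (\<phi> z)))"
    and "(LINT z|lborel. indicator S z *\<^sub>R ((norm (\<phi>' z))\<^sup>2 *\<^sub>R F (\<phi> z))) =
         (LINT w|lborel. indicator (\<phi> ` S) w *\<^sub>R F w)"
proof -
  define S' where "S' = complex_of_vec -` S"
  define g where "g = (\<lambda>x. vec_of_complex (\<phi> (complex_of_vec x)))"
  define g' where "g' = (\<lambda>x h. vec_of_complex (\<phi>' (complex_of_vec x) * complex_of_vec h))"
  define b where "b = (LINT w|lborel. indicator (\<phi> ` S) w *\<^sub>R F w)"
  have S': "S' \<in> sets lebesgue"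
  proof -
    have "complex_of_vec -` S \<inter> space borel \<in> sets borel"
      using S by (rule measurable_sets[OF measurable_complex_of_vec])
    then show ?thesis by (simp add: S'_def)
  qed
  have der': "(g has_derivative g' x) (at x within S')" if "x \<in> S'" for x
  proof -
    have "(\<phi> has_derivative (\<lambda>h. \<phi>' (complex_of_vec x) * h)) (at (complex_of_vec x))"
      using der[of "complex_of_vec x"] that by (simp add: S'_def has_field_derivative_def)
    from has_derivative_compose[OF bounded_linear_imp_has_derivative[OF bounded_linear_complex_of_vec] this]
    have "((\<lambda>x. \<phi> (complex_of_vec x)) has_derivative
          (\<lambda>h. \<phi>' (complex_of_vec x) * complex_of_vec h)) (at x within S')" .
    then show ?thesis
      unfolding g_def g'_def
      by (rule bounded_linear.has_derivative[OF bounded_linear_vec_of_complex])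
  qed
  have inj': "inj_on g S'"
  proof (rule inj_onI)
    fix x y assume "x \<in> S'" "y \<in> S'" "g x = g y"
    then have "complex_of_vec x = complex_of_vec y"
      using inj unfolding g_def S'_def inj_on_def
      by (metis complex_of_vec_of_complex vimageE)
    then show "x = y" by (metis vec_of_complex_of_vec)
  qed
  have img: "g ` S' = complex_of_vec -` (\<phi> ` S)"
  proof (intro equalityI subsetI)
    fix y assume "y \<in> g ` S'"
    then show "y \<in> complex_of_vec -` (\<phi> ` S)" by (auto simp: g_def S'_def)
  next
    fix y assume "y \<in> complex_of_vec -` (\<phi> ` S)"
    then obtain z where z: "z \<in> S" "complex_of_vec y = \<phi> z" by auto
    then have "y = g (vec_of_complex z)" by (metis g_def complex_of_vec_of_complex vec_of_complex_of_vec)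
    then show "y \<in> g ` S'" using z by (simp add: S'_def)
  qed
  have "(\<lambda>x. vec_of_complex (F (complex_of_vec x))) absolutely_integrable_on (g ` S') \<and>
        integral (g ` S') (\<lambda>x. vec_of_complex (F (complex_of_vec x))) = vec_of_complex b"
    using integral_vec_of_complex[OF m1] int by (simp add: img b_def)
  then have *: "(\<lambda>x. \<bar>det (matrix (g' x))\<bar> *\<^sub>R vec_of_complex (F (complex_of_vec (g x))))
         absolutely_integrable_on S' \<and>
      integral S' (\<lambda>x. \<bar>det (matrix (g' x))\<bar> *\<^sub>R vec_of_complex (F (complex_of_vec (g x)))) =
        vec_of_complex b"
    using has_absolute_integral_change_of_variables[OF S' der' inj', where b = "vec_of_complex b"
        and f = "\<lambda>x. vec_of_complex (F (complex_of_vec x))"] by simp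
  have eq: "\<bar>det (matrix (g' x))\<bar> *\<^sub>R vec_of_complex (F (complex_of_vec (g x))) =
     vec_of_complex ((norm (\<phi>' (complex_of_vec x)))\<^sup>2 *\<^sub>R F (\<phi> (complex_of_vec x)))" for x
    by (simp add: g'_def g_def det_complex_mult
        linear_cmul[OF bounded_linear.linear[OF bounded_linear_vec_of_complex]])
  note * = *[unfolded eq S'_def]
  show i: "integrable lborel (\<lambda>z. indicator S z *\<^sub>R ((norm (\<phi>' z))\<^sup>2 *\<^sub>R F (\<phi> z)))"
    using * integral_vec_of_complex(1)[OF m2] by simp
  have "vec_of_complex (LINT z|lborel. indicator S z *\<^sub>R ((norm (\<phi>' z))\<^sup>2 *\<^sub>R F (\<phi> z))) =
      vec_of_complex b"
    using * integral_vec_of_complex(2)[OF m2 i] by simp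
  then show "(LINT z|lborel. indicator S z *\<^sub>R ((norm (\<phi>' z))\<^sup>2 *\<^sub>R F (\<phi> z))) =
         (LINT w|lborel. indicator (\<phi> ` S) w *\<^sub>R F w)"
    unfolding b_def by (metis complex_of_vec_of_complex)
qed

section \<open>The weighted area measure on the disc\<close>

text \<open>The density relative to plain Lebesgue measure, for which the change of variables is
  stated; the factor 1 / pi is the normalisation of area.\<close>

definition bergman_density :: "real \<Rightarrow> complex \<Rightarrow> real" where
  "bergman_density \<alpha> z = indicator unit_disc z * ((\<alpha> + 1) * (1 - (norm z)\<^sup>2) powr \<alpha> / pi)"

lemma bergman_density_nonneg: "\<alpha> > -1 \<Longrightarrow> bergman_density \<alpha> z \<ge> 0"
  by (simp add: bergman_density_def)

lemma unit_disc_borel [measurable]: "unit_disc \<in> sets borel"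
  by simp

lemma measurable_bergman_density [measurable]: "bergman_density \<alpha> \<in> borel_measurable borel"
  unfolding bergman_density_def by measurable

lemma emeasure_disc: "0 \<le> r \<Longrightarrow> emeasure lborel (ball (0::complex) r) = ennreal (pi * r\<^sup>2)"
  by (simp add: emeasure_ball unit_ball_vol_2)

lemma measure_disc: "0 \<le> r \<Longrightarrow> measure lborel (ball (0::complex) r) = pi * r\<^sup>2"
  by (simp add: measure_def emeasure_disc)

lemma bergman_measure_eq:
  assumes "\<alpha> > -1"
  shows "bergman_measure \<alpha> = density lborel (\<lambda>z. ennreal (bergman_density \<alpha> z))"
proof -
  have "bergman_measure \<alpha> = density lborel (\<lambda>z. indicator unit_disc z / ennreal pi *
          ennreal ((\<alpha> + 1) * (1 - (norm z)\<^sup>2) powr \<alpha>))"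
    unfolding bergman_measure_def uniform_measure_def
    by (subst density_density_eq) (auto simp: emeasure_disc)
  also have "(\<lambda>z. indicator unit_disc z / ennreal pi * ennreal ((\<alpha> + 1) * (1 - (norm z)\<^sup>2) powr \<alpha>)) =
     (\<lambda>z. ennreal (bergman_density \<alpha> z))"
    using assms
    by (auto simp: bergman_density_def indicator_def divide_ennreal ennreal_mult[symmetric]
        ennreal_1[symmetric] simp del: ennreal_1)
  finally show ?thesis .
qed

lemma sets_bergman_measure [measurable_cong, simp]: "sets (bergman_measure \<alpha>) = sets borel"
  by (simp add: bergman_measure_def)

lemma space_bergman_measure [simp]: "space (bergman_measure \<alpha>) = UNIV"
  by (simp add: bergman_measure_def)

text \<open>A disc of radius sqrt (1 - x) has area pi (1 - x), so 1 - |z|^2 is uniformly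
  distributed. This does the work of polar coordinates when the total mass is computed.\<close>

lemma distr_one_minus_norm_square:
  "distr (uniform_measure lborel unit_disc) borel (\<lambda>z. 1 - (norm z)\<^sup>2) = uniform_measure lborel {0..1::real}"
proof (rule cdf_unique)
  have p: "prob_space (uniform_measure lborel unit_disc)"
    by (rule prob_space_uniform_measure) (auto simp: emeasure_disc)
  then interpret p: prob_space "uniform_measure lborel unit_disc" .
  interpret u: prob_space "uniform_measure lborel {0..1::real}"
    by (rule prob_space_uniform_measure) auto
  show "real_distribution (distr (uniform_measure lborel unit_disc) borel (\<lambda>z. 1 - (norm z)\<^sup>2))"
    by (intro p.real_distribution_distr) measurable
  show "real_distribution (uniform_measure lborel {0..1::real})"
    by unfold_locales auto
  show "cdf (distr (uniform_measure lborel unit_disc) borel (\<lambda>z. 1 - (norm z)\<^sup>2)) =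
        cdf (uniform_measure lborel {0..1::real})"
  proof
    fix x :: real
    have sq: "(norm z < sqrt t) = ((norm z)\<^sup>2 < t)" for z :: complex and t
      using real_sqrt_less_iff[of "(norm z)\<^sup>2" t] by simp
    have sq1: "(norm z < 1) = ((norm z)\<^sup>2 < 1)" for z :: complex
      using sq[of z 1] by simp
    have "cdf (distr (uniform_measure lborel unit_disc) borel (\<lambda>z. 1 - (norm z)\<^sup>2)) x =
          measure (uniform_measure lborel unit_disc) {z. 1 - (norm z)\<^sup>2 \<le> x}"
      unfolding cdf_def by (subst measure_distr) (auto intro!: arg_cong2[where f=measure])
    also have "\<dots> = measure lborel (unit_disc \<inter> {z. 1 - (norm z)\<^sup>2 \<le> x}) / pi"
      by (subst measure_uniform_measure) (auto simp: emeasure_disc measure_disc)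
    also have "\<dots> = max 0 (min x 1)"
    proof -
      consider "x < 0" | "0 \<le> x" "x < 1" | "1 \<le> x" by linarith
      then show ?thesis
      proof cases
        case 1
        have "unit_disc \<inter> {z. 1 - (norm z)\<^sup>2 \<le> x} = {}"
          using 1 by (auto simp: sq1)
        then show ?thesis using 1 by simp
      next
        case 2
        \<comment> \<open>The event is the annulus sqrt (1 - x) \<le> |z| < 1, of area pi x.\<close>
        have "unit_disc \<inter> {z. 1 - (norm z)\<^sup>2 \<le> x} = ball 0 1 - ball 0 (sqrt (1 - x))"
          using 2 by (auto simp: sq sq1)
        moreover have "measure lborel (ball 0 1 - ball (0::complex) (sqrt (1 - x))) =
            measure lborel (ball (0::complex) 1) - measure lborel (ball (0::complex) (sqrt (1 - x)))"
          using 2 by (intro measure_Diff) (auto simp: emeasure_disc sq sq1)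
        ultimately show ?thesis using 2 by (simp add: measure_disc field_simps)
      next
        case 3
        have "unit_disc \<inter> {z. 1 - (norm z)\<^sup>2 \<le> x} = unit_disc"
          using 3 by (auto intro: order_trans[of _ 1])
        then show ?thesis using 3 by (simp add: measure_disc)
      qed
    qed
    also have "\<dots> = measure lborel ({0..1} \<inter> {..x})"
    proof -
      have "{0..1} \<inter> {..x} = {0..min x 1}" by auto
      then show ?thesis by (auto simp: measure_def max_def min_def)
    qed
    also have "\<dots> = cdf (uniform_measure lborel {0..1::real}) x"
      unfolding cdf_def by (subst measure_uniform_measure) auto
    finally show "cdf (distr (uniform_measure lborel unit_disc) borel (\<lambda>z. 1 - (norm z)\<^sup>2)) x =
        cdf (uniform_measure lborel {0..1::real}) x" .
  qed
qed

text \<open>Pushed forward along 1 - |z|^2, the total mass becomes the integral of (\<alpha> + 1)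
  s^\<alpha> over [0, 1]. This is 1, the singularity at 0 being integrable for \<alpha> >
  -1.\<close>

lemma prob_space_bergman:
  assumes "\<alpha> > -1"
  shows "prob_space (bergman_measure \<alpha>)"
proof
  have "emeasure (bergman_measure \<alpha>) (space (bergman_measure \<alpha>)) =
     (\<integral>\<^sup>+z. ennreal ((\<alpha> + 1) * (1 - (norm z)\<^sup>2) powr \<alpha>) \<partial>uniform_measure lborel unit_disc)"
    unfolding bergman_measure_def by (subst emeasure_density) auto
  also have "\<dots> = (\<integral>\<^sup>+s. ennreal ((\<alpha> + 1) * s powr \<alpha>)
        \<partial>distr (uniform_measure lborel unit_disc) borel (\<lambda>z. 1 - (norm z)\<^sup>2))"
    by (subst nn_integral_distr) auto
  also have "\<dots> = (\<integral>\<^sup>+s. ennreal ((\<alpha> + 1) * s powr \<alpha>) \<partial>uniform_measure lborel {0..1::real})"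
    by (simp only: distr_one_minus_norm_square)
  also have "\<dots> = (\<integral>\<^sup>+s. ennreal ((\<alpha> + 1) * s powr \<alpha>) * indicator {0..1} s \<partial>lborel)"
    by (subst nn_integral_uniform_measure) (auto simp: divide_ennreal_def)
  also have "\<dots> = ennreal (1::real)"
  proof (rule nn_integral_has_integral_lebesgue')
    have "((\<lambda>s. (\<alpha> + 1) * s powr \<alpha>) has_integral (\<alpha> + 1) * (1 powr (\<alpha> + 1) / (\<alpha> + 1))) {0..1}"
      by (intro has_integral_mult_right has_integral_powr_from_0) (use assms in auto)
    then show "((\<lambda>s. (\<alpha> + 1) * s powr \<alpha>) has_integral 1) {0..1}"
      using assms by simp
  qed (use assms in auto)
  finally show "emeasure (bergman_measure \<alpha>) (space (bergman_measure \<alpha>)) = 1" by simp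
qed

section \<open>Integrals against the weighted measure and rotation invariance\<close>

lemma
  fixes F :: "complex \<Rightarrow> 'b::{banach, second_countable_topology}"
  assumes "\<alpha> > -1" "F \<in> borel_measurable borel"
  shows integrable_bergman_measure_iff:
      "integrable (bergman_measure \<alpha>) F \<longleftrightarrow> integrable lborel (\<lambda>z. bergman_density \<alpha> z *\<^sub>R F z)"
    and integral_bergman_measure:
      "(LINT z|bergman_measure \<alpha>. F z) = (LINT z|lborel. bergman_density \<alpha> z *\<^sub>R F z)"
  using assms bergman_density_nonneg[OF assms(1)]
  by (simp_all add: bergman_measure_eq integrable_density integral_density)

text \<open>The substitution has a derivative of modulus 1 and the density is radial, so neither the
  Jacobian nor the weight changes.\<close>

lemma integral_bergman_rotation_complex:
  fixes F :: "complex \<Rightarrow> complex"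
  assumes \<alpha>: "\<alpha> > -1" and [measurable]: "F \<in> borel_measurable borel" and \<zeta>: "norm \<zeta> = 1"
    and F: "integrable (bergman_measure \<alpha>) F"
  shows "(LINT z|bergman_measure \<alpha>. F (\<zeta> * z)) = (LINT z|bergman_measure \<alpha>. F z)"
proof -
  define G where "G = (\<lambda>z. bergman_density \<alpha> z *\<^sub>R F z)"
  have [measurable]: "G \<in> borel_measurable borel" unfolding G_def by measurable
  have "\<zeta> \<noteq> 0" using \<zeta> by auto
  have range: "range ((*) \<zeta>) = UNIV"
    by (rule surjI[of _ "\<lambda>z. z / \<zeta>"]) (simp add: \<open>\<zeta> \<noteq> 0\<close>)
  have dens: "bergman_density \<alpha> (\<zeta> * z) = bergman_density \<alpha> z" for z
    using \<zeta> by (simp add: bergman_density_def norm_mult indicator_def)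
  have G: "integrable lborel G"
    using F \<alpha> by (simp add: integrable_bergman_measure_iff G_def)
  have "((*) \<zeta> has_field_derivative \<zeta>) (at z)" for z
    by (auto intro!: derivative_eq_intros)
  then have cov: "(LINT z|lborel. indicator UNIV z *\<^sub>R ((norm \<zeta>)\<^sup>2 *\<^sub>R G (\<zeta> * z))) =
      (LINT w|lborel. indicator (range ((*) \<zeta>)) w *\<^sub>R G w)"
    using \<open>\<zeta> \<noteq> 0\<close> G
    by (intro complex_change_of_variables[where \<phi>' = "\<lambda>_. \<zeta>"]; simp add: range inj_on_def)
  show "(LINT z|bergman_measure \<alpha>. F (\<zeta> * z)) = (LINT z|bergman_measure \<alpha>. F z)"
    using cov \<zeta> \<alpha> range by (simp add: integral_bergman_measure G_def dens)
qed

text \<open>The preceding formula, applied to complex-valued indicators, gives equality of measures;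
  invariance then transfers to integrands of other types through \<open>distr\<close>.\<close>

lemma bergman_measure_rotation:
  assumes \<alpha>: "\<alpha> > -1" and \<zeta>: "norm \<zeta> = 1"
  shows "distr (bergman_measure \<alpha>) borel ((*) \<zeta>) = bergman_measure \<alpha>"
proof (rule measure_eqI)
  interpret prob_space "bergman_measure \<alpha>" by (rule prob_space_bergman) fact
  fix A assume "A \<in> sets (distr (bergman_measure \<alpha>) borel ((*) \<zeta>))"
  then have A [measurable]: "A \<in> sets borel" by simp
  have m: "(*) \<zeta> -` A \<in> sets borel"
    using measurable_sets[of "(*) \<zeta>" borel borel A] by simp
  have "complex_of_real (measure (bergman_measure \<alpha>) ((*) \<zeta> -` A)) =
      (LINT z|bergman_measure \<alpha>. complex_of_real (indicator A (\<zeta> * z)))"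
  proof -
    have "(LINT z|bergman_measure \<alpha>. complex_of_real (indicator A (\<zeta> * z))) =
      (LINT z|bergman_measure \<alpha>. complex_of_real (indicator ((*) \<zeta> -` A) z))"
      by (rule Bochner_Integration.integral_cong) (auto simp: indicator_def)
    then show ?thesis using m by simp
  qed
  also have "\<dots> = (LINT z|bergman_measure \<alpha>. complex_of_real (indicator A z))"
    by (rule integral_bergman_rotation_complex[OF \<alpha> _ \<zeta>])
       (auto intro!: integrable_of_real integrable_real_indicator simp: emeasure_eq_measure)
  also have "\<dots> = complex_of_real (measure (bergman_measure \<alpha>) A)"
    by simp
  finally show "emeasure (distr (bergman_measure \<alpha>) borel ((*) \<zeta>)) A = emeasure (bergman_measure \<alpha>) A"
    using m by (subst emeasure_distr) (auto simp: emeasure_eq_measure)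
qed simp

section \<open>Mean values over circles and integrals with radial weights\<close>

lemma has_integral_circle_mean:
  assumes "f holomorphic_on cball 0 1"
  shows "((\<lambda>t. f (exp (2 * of_real pi * \<i> * of_real t))) has_integral f 0) {0..1}"
proof -
  \<comment> \<open>Cauchy's formula at the centre: on u = exp (2 pi i t) the factor 1 / u cancels
    the u in du = 2 pi i u dt.\<close>
  have "((\<lambda>t. 2 * of_real pi * \<i> * f (exp (2 * of_real pi * \<i> * of_real t)))
          has_integral (2 * of_real pi * \<i> * f 0)) {0..1}"
  proof (rule has_integral_eq)
    show "((\<lambda>t. (\<lambda>u. f u / (u - 0)) (circlepath 0 1 t) *
              vector_derivative (circlepath 0 1) (at t within {0..1}))
            has_integral (2 * of_real pi * \<i> * f 0)) {0..1}"
      using Cauchy_integral_circlepath_simple[OF assms, of 0] by (simp add: has_contour_integral_def)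
  next
    fix t :: real assume "t \<in> {0..1}"
    then show "(\<lambda>u. f u / (u - 0)) (circlepath 0 1 t) *
        vector_derivative (circlepath 0 1) (at t within {0..1}) =
        2 * of_real pi * \<i> * f (exp (2 * of_real pi * \<i> * of_real t))"
      by (subst vector_derivative_circlepath01) (auto simp: circlepath)
  qed
  then have "((\<lambda>t. (2 * of_real pi * \<i> * f (exp (2 * of_real pi * \<i> * of_real t))) / (2 * of_real pi * \<i>))
          has_integral (2 * of_real pi * \<i> * f 0) / (2 * of_real pi * \<i>)) {0..1}"
    by (rule has_integral_divide)
  then show ?thesis by simp
qed

text \<open>Membership in the space without square integrability. The zero extension makes such
  functions Borel measurable on the whole plane.\<close>

definition disc_function :: "(complex \<Rightarrow> complex) \<Rightarrow> bool" where
  "disc_function f \<longleftrightarrow> f holomorphic_on unit_disc \<and> (\<forall>z. z \<notin> unit_disc \<longrightarrow> f z = 0)"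

lemma disc_function_measurable:
  assumes "disc_function f"
  shows "f \<in> borel_measurable borel"
proof -
  have "(\<lambda>z. indicator unit_disc z *\<^sub>R f z) \<in> borel_measurable borel"
    using assms unfolding disc_function_def
    by (intro borel_measurable_continuous_on_indicator holomorphic_on_imp_continuous_on) auto
  also have "(\<lambda>z. indicator unit_disc z *\<^sub>R f z) = f"
    using assms by (auto simp: disc_function_def indicator_def)
  finally show ?thesis .
qed

lemma AE_bergman_measure:
  assumes "\<alpha> > -1"
  shows "AE z in bergman_measure \<alpha>. z \<in> unit_disc"
  unfolding bergman_measure_eq[OF assms]
  by (subst AE_density) (auto simp: bergman_density_def indicator_def)

text \<open>The mean value property is applied to the function u -> f (u z), which is holomorphic on
  the closed disc because |z| < 1, even if f is not.\<close>

lemma lborel_integral_circle_mean: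
  assumes f: "disc_function f" and z: "z \<in> unit_disc"
  shows "(LINT t|lborel. indicator {0..1} t *\<^sub>R f (exp (2 * of_real pi * \<i> * of_real t) * z)) = f 0"
proof -
  have "f holomorphic_on unit_disc" using f by (simp add: disc_function_def)
  then have hol: "(\<lambda>u. f (u * z)) holomorphic_on cball 0 1"
  proof (intro holomorphic_on_compose_gen[of "\<lambda>u. u * z" _ f unit_disc, unfolded o_def])
    show "(\<lambda>u. u * z) ` cball 0 1 \<subseteq> unit_disc"
    proof clarsimp
      fix u :: complex assume "norm u \<le> 1"
      then have "norm u * norm z \<le> 1 * norm z" by (intro mult_right_mono) auto
      then show "norm (u * z) < 1" using z by (simp add: norm_mult)
    qed
  qed (auto intro!: holomorphic_intros)
  have I: "((\<lambda>t. f (exp (2 * of_real pi * \<i> * of_real t) * z)) has_integral f 0) {0..1}"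
    using has_integral_circle_mean[OF hol] by simp
  have "continuous_on {0..1} (\<lambda>t. f (exp (2 * of_real pi * \<i> * of_real t) * z))"
    by (rule continuous_on_compose2[OF holomorphic_on_imp_continuous_on[OF hol],
          of _ "\<lambda>t. exp (2 * of_real pi * \<i> * of_real t)"])
       (auto intro!: continuous_intros)
  then have "set_integrable lborel {0..1} (\<lambda>t. f (exp (2 * of_real pi * \<i> * of_real t) * z))"
    by (rule borel_integrable_atLeastAtMost')
  from set_borel_integral_eq_integral(2)[OF this] show ?thesis
    using I by (simp add: set_lebesgue_integral_def integral_unique)
qed

text \<open>By rotation invariance the integrand may be averaged over all rotations. Fubini lets the
  average be taken first on each circle, where the radial weight is constant and f averages to its
  value at 0. This identity yields the orthogonality of monomials, the coefficient formula and the
  vanishing cross term in the subordination estimate.\<close>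

lemma integral_bergman_radial:
  assumes \<alpha>: "\<alpha> > -1" and f: "disc_function f"
    and int: "integrable (bergman_measure \<alpha>) (\<lambda>z. norm z ^ m *\<^sub>R f z)"
  shows "(LINT z|bergman_measure \<alpha>. norm z ^ m *\<^sub>R f z) =
         (LINT z|bergman_measure \<alpha>. norm z ^ m) *\<^sub>R f 0"
proof -
  interpret \<mu>: prob_space "bergman_measure \<alpha>" by (rule prob_space_bergman) fact
  interpret pair_sigma_finite lborel "bergman_measure \<alpha>" ..
  have [measurable]: "f \<in> borel_measurable borel" by (rule disc_function_measurable) fact
  define e where "e = (\<lambda>t::real. exp (2 * of_real pi * \<i> * of_real t))"
  have [measurable]: "e \<in> borel_measurable borel"
    unfolding e_def by (intro borel_measurable_continuous_onI continuous_intros)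
  have norm_e: "norm (e t) = 1" for t by (simp add: e_def)
  define G where "G = (\<lambda>z. norm z ^ m *\<^sub>R f z)"
  have [measurable]: "G \<in> borel_measurable borel" unfolding G_def by measurable
  \<comment> \<open>The indicator restricts t to one full turn, so that averaging over t has total
    mass 1.\<close>
  define U where "U = (\<lambda>t z. indicator {0..1} t *\<^sub>R G (e t * z))"
  have intG: "integrable (bergman_measure \<alpha>) G" using int by (simp add: G_def)
  have rotG: "integrable (bergman_measure \<alpha>) (\<lambda>z. G (e t * z))" for t
    using intG bergman_measure_rotation[OF \<alpha> norm_e[of t]]
      integrable_distr_eq[of "(*) (e t)" "bergman_measure \<alpha>" borel G] by simp
  have rotn: "(LINT z|bergman_measure \<alpha>. H (e t * z)) = (LINT z|bergman_measure \<alpha>. H z)"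
    if [measurable]: "H \<in> borel_measurable borel"
    for t and H :: "complex \<Rightarrow> 'b::{banach, second_countable_topology}"
    using bergman_measure_rotation[OF \<alpha> norm_e[of t]]
      integral_distr[of "(*) (e t)" "bergman_measure \<alpha>" borel H] by simp
  have norm_U: "(LINT z|bergman_measure \<alpha>. norm (U t z)) =
      indicator {0..1} t *\<^sub>R (LINT z|bergman_measure \<alpha>. norm (G z))" for t
    using rotn[of "\<lambda>z. norm (G z)" t] by (simp add: U_def)
  have "integrable (lborel \<Otimes>\<^sub>M bergman_measure \<alpha>) (\<lambda>(t, z). U t z)"
  proof (rule Fubini_integrable)
    show "(\<lambda>(t, z). U t z) \<in> borel_measurable (lborel \<Otimes>\<^sub>M bergman_measure \<alpha>)"
      unfolding U_def by measurable
    show "integrable lborel (\<lambda>t. LINT z|bergman_measure \<alpha>. norm (case (t, z) of (t, z) \<Rightarrow> U t z))"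
      unfolding prod.case norm_U by (intro integrable_scaleR_left integrable_real_indicator) auto
    show "AE t in lborel. integrable (bergman_measure \<alpha>) (\<lambda>z. case (t, z) of (t, z) \<Rightarrow> U t z)"
      using rotG by (simp add: U_def)
  qed
  from Fubini_integral[OF this]
  have "(LINT z|bergman_measure \<alpha>. LINT t|lborel. U t z) =
      (LINT t|lborel. LINT z|bergman_measure \<alpha>. U t z)" .
  also have "\<dots> = (LINT t::real|lborel. indicator {0..1} t *\<^sub>R (LINT z|bergman_measure \<alpha>. G z))"
    by (rule Bochner_Integration.integral_cong) (simp_all add: U_def rotn[of G])
  also have "\<dots> = (LINT z|bergman_measure \<alpha>. G z)"
    by (subst integral_scaleR_left) auto
  finally have "(LINT z|bergman_measure \<alpha>. G z) = (LINT z|bergman_measure \<alpha>. LINT t|lborel. U t z)" ..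
  also have "\<dots> = (LINT z|bergman_measure \<alpha>. norm z ^ m *\<^sub>R f 0)"
  proof (rule integral_cong_AE)
    show "AE z in bergman_measure \<alpha>. (LINT t|lborel. U t z) = norm z ^ m *\<^sub>R f 0"
      using AE_bergman_measure[OF \<alpha>]
    proof eventually_elim
      case (elim z)
      have "(LINT t|lborel. U t z) =
          (LINT t|lborel. norm z ^ m *\<^sub>R (indicator {0..1} t *\<^sub>R f (e t * z)))"
        by (rule Bochner_Integration.integral_cong) (auto simp: U_def G_def norm_mult norm_e)
      also have "\<dots> = norm z ^ m *\<^sub>R f 0"
        using lborel_integral_circle_mean[OF f elim] by (simp add: e_def del: scaleR_scaleR)
      finally show ?case .
    qed
    show "(\<lambda>z. LINT t|lborel. U t z) \<in> borel_measurable (bergman_measure \<alpha>)"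
      unfolding U_def by measurable
  qed auto
  also have "\<dots> = (LINT z|bergman_measure \<alpha>. norm z ^ m) *\<^sub>R f 0"
  proof (rule integral_scaleR_left)
    show "integrable (bergman_measure \<alpha>) (\<lambda>z. norm z ^ m)"
    proof (rule \<mu>.integrable_const_bound[where B = 1])
      show "AE z in bergman_measure \<alpha>. norm (norm z ^ m) \<le> 1"
        using AE_bergman_measure[OF \<alpha>] by eventually_elim (auto simp: power_le_one)
    qed auto
  qed
  finally show ?thesis by (simp add: G_def)
qed

section \<open>Inner product space structure\<close>

lemma measurable_cnj [measurable]: "cnj \<in> borel_measurable borel"
  by (intro borel_measurable_continuous_onI continuous_intros)

locale weighted_bergman =
  fixes \<alpha> :: real
  assumes \<alpha>: "\<alpha> > -1"
begin

abbreviation "\<mu> \<equiv> bergman_measure \<alpha>"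
abbreviation "ip \<equiv> bergman_inner \<alpha>"
abbreviation "nrm \<equiv> bergman_norm \<alpha>"
abbreviation "A2 \<equiv> bergman_space \<alpha>"

sublocale prob_space \<mu>
  by (rule prob_space_bergman) (rule \<alpha>)

lemma space_iff: "f \<in> A2 \<longleftrightarrow> disc_function f \<and> integrable \<mu> (\<lambda>z. (norm (f z))\<^sup>2)"
  by (auto simp: bergman_space_def disc_function_def)

lemma space_measurable: "f \<in> A2 \<Longrightarrow> f \<in> borel_measurable borel"
  by (auto simp: space_iff disc_function_measurable)

lemma disc_function_add: "disc_function f \<Longrightarrow> disc_function g \<Longrightarrow> disc_function (\<lambda>z. f z + g z)"
  by (auto simp: disc_function_def intro!: holomorphic_intros)

lemma disc_function_cmult: "disc_function f \<Longrightarrow> disc_function (\<lambda>z. c * f z)"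
  by (auto simp: disc_function_def intro!: holomorphic_intros)

lemma integrable_norm_square_add:
  fixes f g :: "complex \<Rightarrow> complex"
  assumes [measurable]: "f \<in> borel_measurable borel" "g \<in> borel_measurable borel"
    and "integrable \<mu> (\<lambda>z. (norm (f z))\<^sup>2)" "integrable \<mu> (\<lambda>z. (norm (g z))\<^sup>2)"
  shows "integrable \<mu> (\<lambda>z. (norm (f z + g z))\<^sup>2)"
proof (rule Bochner_Integration.integrable_bound)
  show "integrable \<mu> (\<lambda>z. 2 * (norm (f z))\<^sup>2 + 2 * (norm (g z))\<^sup>2)"
    using assms by auto
  show "AE z in \<mu>. norm ((norm (f z + g z))\<^sup>2) \<le> norm (2 * (norm (f z))\<^sup>2 + 2 * (norm (g z))\<^sup>2)"
  proof (rule AE_I2)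
    fix z
    have "(norm (f z + g z))\<^sup>2 \<le> (norm (f z) + norm (g z))\<^sup>2"
      by (intro power_mono norm_triangle_ineq) auto
    also have "\<dots> \<le> 2 * (norm (f z))\<^sup>2 + 2 * (norm (g z))\<^sup>2"
      using sum_squares_bound[of "norm (f z)" "norm (g z)"] by (simp add: power2_sum)
    finally show "norm ((norm (f z + g z))\<^sup>2) \<le> norm (2 * (norm (f z))\<^sup>2 + 2 * (norm (g z))\<^sup>2)"
      by simp
  qed
qed measurable

lemma add_space: "f \<in> A2 \<Longrightarrow> g \<in> A2 \<Longrightarrow> (\<lambda>z. f z + g z) \<in> A2"
  by (auto simp: space_iff disc_function_add disc_function_measurable intro!: integrable_norm_square_add)

lemma cmult_space: "f \<in> A2 \<Longrightarrow> (\<lambda>z. c * f z) \<in> A2"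
  by (auto simp: space_iff disc_function_cmult norm_mult power_mult_distrib)

lemma diff_space: "f \<in> A2 \<Longrightarrow> g \<in> A2 \<Longrightarrow> (\<lambda>z. f z - g z) \<in> A2"
  using add_space[of f "\<lambda>z. -1 * g z"] cmult_space[of g "-1"] by simp

lemma zero_space: "(\<lambda>z. 0) \<in> A2"
  by (auto simp: space_iff disc_function_def)

lemma sum_space: "(\<And>k. k \<in> I \<Longrightarrow> F k \<in> A2) \<Longrightarrow> (\<lambda>z. \<Sum>k\<in>I. F k z) \<in> A2"
  by (induction I rule: infinite_finite_induct) (auto intro: zero_space add_space)

lemma integrable_inner:
  fixes f g :: "complex \<Rightarrow> complex"
  assumes [measurable]: "f \<in> borel_measurable borel" "g \<in> borel_measurable borel"
    and "integrable \<mu> (\<lambda>z. (norm (f z))\<^sup>2)" "integrable \<mu> (\<lambda>z. (norm (g z))\<^sup>2)"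
  shows "integrable \<mu> (\<lambda>z. f z * cnj (g z))"
proof (rule Bochner_Integration.integrable_bound)
  show "integrable \<mu> (\<lambda>z. (norm (f z))\<^sup>2 + (norm (g z))\<^sup>2)"
    using assms by auto
  show "AE z in \<mu>. norm (f z * cnj (g z)) \<le> norm ((norm (f z))\<^sup>2 + (norm (g z))\<^sup>2)"
  proof (rule AE_I2)
    fix z
    have "norm (f z) * norm (g z) \<le> (norm (f z))\<^sup>2 + (norm (g z))\<^sup>2"
      using sum_squares_bound[of "norm (f z)" "norm (g z)"]
        mult_nonneg_nonneg[OF norm_ge_zero[of "f z"] norm_ge_zero[of "g z"]] by linarith
    then show "norm (f z * cnj (g z)) \<le> norm ((norm (f z))\<^sup>2 + (norm (g z))\<^sup>2)"
      by (simp add: norm_mult)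
  qed
qed measurable

lemma integrable_inner_space: "f \<in> A2 \<Longrightarrow> g \<in> A2 \<Longrightarrow> integrable \<mu> (\<lambda>z. f z * cnj (g z))"
  by (intro integrable_inner space_measurable) (auto simp: space_iff)

lemma inner_add_left: "f \<in> A2 \<Longrightarrow> g \<in> A2 \<Longrightarrow> h \<in> A2 \<Longrightarrow> ip (\<lambda>z. f z + g z) h = ip f h + ip g h"
  unfolding bergman_inner_def by (simp add: algebra_simps integrable_inner_space)

lemma inner_diff_left: "f \<in> A2 \<Longrightarrow> g \<in> A2 \<Longrightarrow> h \<in> A2 \<Longrightarrow> ip (\<lambda>z. f z - g z) h = ip f h - ip g h"
  unfolding bergman_inner_def by (simp add: algebra_simps integrable_inner_space)

lemma inner_cmult_left: "ip (\<lambda>z. c * f z) g = c * ip f g"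
  unfolding bergman_inner_def by (simp add: mult.assoc)

lemma inner_zero_left: "ip (\<lambda>z. 0) g = 0"
  unfolding bergman_inner_def by simp

lemma inner_commute: "ip f g = cnj (ip g f)"
proof -
  have "cnj (LINT z|\<mu>. g z * cnj (f z)) = (LINT z|\<mu>. cnj (g z * cnj (f z)))"
    by (rule Bochner_Integration.integral_cnj[symmetric])
  then show ?thesis unfolding bergman_inner_def by (simp add: mult.commute)
qed

lemma inner_diff_right: "f \<in> A2 \<Longrightarrow> g \<in> A2 \<Longrightarrow> h \<in> A2 \<Longrightarrow> ip h (\<lambda>z. f z - g z) = ip h f - ip h g"
  using inner_diff_left[of f g h] inner_commute[of h] by simp

lemma inner_sum_left:
  assumes "\<And>k. k \<in> I \<Longrightarrow> F k \<in> A2" "g \<in> A2"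
  shows "ip (\<lambda>z. \<Sum>k\<in>I. c k * F k z) g = (\<Sum>k\<in>I. c k * ip (F k) g)"
  using assms(1)
proof (induction I rule: infinite_finite_induct)
  case (insert k I)
  then have "ip (\<lambda>z. c k * F k z + (\<Sum>k\<in>I. c k * F k z)) g =
      c k * ip (F k) g + ip (\<lambda>z. \<Sum>k\<in>I. c k * F k z) g"
    using assms(2) by (subst inner_add_left) (auto intro!: cmult_space sum_space simp: inner_cmult_left)
  with insert show ?case by simp
qed (auto simp: inner_zero_left)

lemma nrm_nonneg: "nrm f \<ge> 0"
  by (simp add: bergman_norm_def)

lemma nrm_square: "(nrm f)\<^sup>2 = (LINT z|\<mu>. (norm (f z))\<^sup>2)"
  by (simp add: bergman_norm_def)

lemma inner_self: "ip f f = of_real ((nrm f)\<^sup>2)"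
  unfolding nrm_square bergman_inner_def by (simp add: complex_norm_square[symmetric] flip: of_real_power)

lemma nrm_diff_square:
  assumes "f \<in> A2" "g \<in> A2"
  shows "(nrm (\<lambda>z. f z - g z))\<^sup>2 = (nrm f)\<^sup>2 + (nrm g)\<^sup>2 - 2 * Re (ip f g)"
proof -
  have "complex_of_real ((nrm (\<lambda>z. f z - g z))\<^sup>2) = ip f f - ip g f - (ip f g - ip g g)"
    unfolding inner_self[symmetric] using assms
    by (simp add: inner_diff_left inner_diff_right diff_space)
  also have "\<dots> = of_real ((nrm f)\<^sup>2 + (nrm g)\<^sup>2) - (ip f g + cnj (ip f g))"
    by (simp add: inner_self inner_commute[of g f])
  also have "\<dots> = of_real ((nrm f)\<^sup>2 + (nrm g)\<^sup>2 - 2 * Re (ip f g))"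
    by (simp add: complex_add_cnj)
  finally show ?thesis by (simp only: of_real_eq_iff)
qed

lemma cauchy_schwarz:
  assumes "f \<in> A2" "g \<in> A2"
  shows "norm (ip f g) \<le> nrm f * nrm g"
proof -
  have [measurable]: "f \<in> borel_measurable borel" "g \<in> borel_measurable borel"
    using assms space_measurable by auto
  have i: "integrable \<mu> (\<lambda>z. norm (f z) * norm (g z))"
    using integrable_norm[OF integrable_inner_space[OF assms]] by (simp add: norm_mult)
  have "norm (ip f g) \<le> (LINT z|\<mu>. norm (f z) * norm (g z))" (is "_ \<le> ?x")
    unfolding bergman_inner_def using integral_norm_bound[of \<mu> "\<lambda>z. f z * cnj (g z)"]
    by (simp add: norm_mult)
  have sq: "(\<integral>\<^sup>+z. ennreal ((norm (h z))\<^sup>2) \<partial>\<mu>) = ennreal ((nrm h)\<^sup>2)" if "h \<in> A2" for h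
    using that unfolding nrm_square space_iff
    by (simp add: nn_integral_eq_integral)
  have "(\<integral>\<^sup>+z. ennreal (norm (f z)) * ennreal (norm (g z)) \<partial>\<mu>)\<^sup>2 \<le>
      (\<integral>\<^sup>+z. (ennreal (norm (f z)))\<^sup>2 \<partial>\<mu>) * (\<integral>\<^sup>+z. (ennreal (norm (g z)))\<^sup>2 \<partial>\<mu>)"
    by (rule Cauchy_Schwarz_nn_integral) auto
  also have "(\<integral>\<^sup>+z. ennreal (norm (f z)) * ennreal (norm (g z)) \<partial>\<mu>) = ennreal ?x"
    using i by (simp add: ennreal_mult[symmetric] nn_integral_eq_integral)
  finally have "?x\<^sup>2 \<le> (nrm f * nrm g)\<^sup>2"
    using assms by (simp add: sq ennreal_power ennreal_mult[symmetric] power_mult_distrib)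
  then have "?x \<le> nrm f * nrm g"
    by (rule power2_le_imp_le) (simp add: nrm_nonneg)
  with \<open>norm (ip f g) \<le> ?x\<close> show ?thesis by simp
qed

text \<open>The density is positive on the disc, so the exceptional set is Lebesgue-null there,
  whereas a nonempty open set is not.\<close>

lemma AE_open_witness:
  assumes "AE z in \<mu>. P z" "open U" "U \<noteq> {}" "U \<subseteq> unit_disc"
  obtains z where "z \<in> U" "P z"
proof -
  have "AE z in lborel. 0 < bergman_density \<alpha> z \<longrightarrow> P z"
    using assms(1) unfolding bergman_measure_eq[OF \<alpha>] by (subst (asm) AE_density) auto
  then have ae: "AE z in lborel. z \<in> unit_disc \<longrightarrow> P z"
  proof eventually_elim
    case (elim z)
    have "z \<in> unit_disc \<Longrightarrow> (norm z)\<^sup>2 < 1" by (simp add: abs_square_less_1)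
    then show ?case using elim \<alpha> by (auto simp: bergman_density_def)
  qed
  show ?thesis
  proof (rule ccontr)
    assume "\<not> ?thesis"
    then have "\<forall>z\<in>U. \<not> P z" using that by blast
    with ae have "AE z in lborel. z \<notin> U"
      using assms(4) by (auto elim!: eventually_mono)
    then have "U \<in> null_sets lborel"
      using assms(2) by (subst AE_iff_null_sets) auto
    then have "negligible U"
      by (simp add: negligible_iff_null_sets null_sets_completionI)
    with open_not_negligible assms show False by blast
  qed
qed

text \<open>Turns strictness on one nonempty open set into strictness of the integral, both for
  moments and for the equality case of Schwarz' lemma.\<close>

lemma integral_pos:
  assumes "integrable \<mu> f" "\<And>z. 0 \<le> f z" "open U" "U \<noteq> {}" "U \<subseteq> unit_disc" "\<And>z. z \<in> U \<Longrightarrow> f z > (0::real)"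
  shows "(LINT z|\<mu>. f z) > 0"
proof -
  have "(LINT z|\<mu>. f z) \<noteq> 0"
  proof
    assume "(LINT z|\<mu>. f z) = 0"
    then have "AE z in \<mu>. f z = 0"
      using integral_nonneg_eq_0_iff_AE[of \<mu> f] assms by auto
    then obtain z where "z \<in> U" "f z = 0" using AE_open_witness[OF _ assms(3-5)] by blast
    with assms(6)[of z] show False by simp
  qed
  moreover have "(LINT z|\<mu>. f z) \<ge> 0" using assms by (intro integral_nonneg_AE) auto
  ultimately show ?thesis by simp
qed

text \<open>Fatou's lemma for squared norms. Through it, estimates for polynomials pass to infinite
  expansions; convergence on the disc suffices because the complement is null.\<close>

lemma fatou_square:
  fixes u :: "complex \<Rightarrow> complex"
  assumes [measurable]: "\<And>n. U n \<in> borel_measurable borel" "u \<in> borel_measurable borel"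
    and lim: "\<And>z. z \<in> unit_disc \<Longrightarrow> (\<lambda>n. U n z) \<longlonglongrightarrow> u z"
    and int: "\<And>n. integrable \<mu> (\<lambda>z. (norm (U n z))\<^sup>2)"
    and le: "\<And>n. (LINT z|\<mu>. (norm (U n z))\<^sup>2) \<le> C"
  shows "integrable \<mu> (\<lambda>z. (norm (u z))\<^sup>2)" "(LINT z|\<mu>. (norm (u z))\<^sup>2) \<le> C"
proof -
  \<comment> \<open>\<open>ennreal\<close> sends negative numbers to 0, so \<open>C\<close> must be
    nonnegative before a bound by \<open>ennreal C\<close> can be read as a real inequality.\<close>
  have "0 \<le> (LINT z|\<mu>. (norm (U 0 z))\<^sup>2)"
    by (rule Bochner_Integration.integral_nonneg) simp
  with le[of 0] have C: "0 \<le> C" by linarith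
  have "(\<integral>\<^sup>+z. ennreal ((norm (u z))\<^sup>2) \<partial>\<mu>) = (\<integral>\<^sup>+z. liminf (\<lambda>n. ennreal ((norm (U n z))\<^sup>2)) \<partial>\<mu>)"
  proof (rule nn_integral_cong_AE)
    show "AE z in \<mu>. ennreal ((norm (u z))\<^sup>2) = liminf (\<lambda>n. ennreal ((norm (U n z))\<^sup>2))"
      using AE_bergman_measure[OF \<alpha>]
    proof eventually_elim
      case (elim z)
      have "(\<lambda>n. ennreal ((norm (U n z))\<^sup>2)) \<longlonglongrightarrow> ennreal ((norm (u z))\<^sup>2)"
        by (intro tendsto_ennrealI tendsto_intros lim elim)
      then show ?case by (metis lim_imp_Liminf trivial_limit_sequentially)
    qed
  qed
  also have "\<dots> \<le> liminf (\<lambda>n. \<integral>\<^sup>+z. ennreal ((norm (U n z))\<^sup>2) \<partial>\<mu>)"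
    by (rule nn_integral_liminf) measurable
  also have "\<dots> \<le> liminf (\<lambda>n. ennreal C)"
    using int le by (intro Liminf_mono always_eventually allI) (simp add: nn_integral_eq_integral ennreal_leI)
  also have "\<dots> = ennreal C" by (simp add: Liminf_const)
  finally have *: "(\<integral>\<^sup>+z. ennreal ((norm (u z))\<^sup>2) \<partial>\<mu>) \<le> ennreal C" .
  show i: "integrable \<mu> (\<lambda>z. (norm (u z))\<^sup>2)"
    by (rule integrableI_bounded) (use * in \<open>auto intro: le_less_trans\<close>)
  show "(LINT z|\<mu>. (norm (u z))\<^sup>2) \<le> C"
    using * C i by (simp add: nn_integral_eq_integral)
qed
end

section \<open>Power series expansions\<close>

definition disc_monomial :: "nat \<Rightarrow> complex \<Rightarrow> complex" where
  "disc_monomial n = (\<lambda>z. if z \<in> unit_disc then z ^ n else 0)"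

definition disc_expansion :: "(complex \<Rightarrow> complex) \<Rightarrow> (nat \<Rightarrow> complex) \<Rightarrow> bool" where
  "disc_expansion f b \<longleftrightarrow> (\<forall>z\<in>unit_disc. (\<lambda>k. b k * z ^ k) sums f z)"

definition disc_polynomial :: "(nat \<Rightarrow> complex) \<Rightarrow> nat \<Rightarrow> complex \<Rightarrow> complex" where
  "disc_polynomial b N = (\<lambda>z. \<Sum>k<N. b k * disc_monomial k z)"

lemma disc_function_extend:
  assumes "f holomorphic_on unit_disc"
  shows "disc_function (\<lambda>z. if z \<in> unit_disc then f z else 0)"
proof -
  have "(\<lambda>z. if z \<in> unit_disc then f z else 0) holomorphic_on unit_disc \<longleftrightarrow> f holomorphic_on unit_disc"
    by (rule holomorphic_cong) auto
  with assms show ?thesis by (simp add: disc_function_def)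
qed

lemma disc_function_monomial: "disc_function (disc_monomial n)"
  unfolding disc_monomial_def by (intro disc_function_extend holomorphic_intros)

lemma disc_function_expansion:
  "disc_function f \<Longrightarrow> disc_expansion f (\<lambda>k. (deriv ^^ k) f 0 / fact k)"
  unfolding disc_function_def disc_expansion_def using holomorphic_power_series[of f 0 1] by auto

lemma disc_expansion_function:
  assumes "disc_expansion f b" "\<And>z. z \<notin> unit_disc \<Longrightarrow> f z = 0"
  shows "disc_function f"
  using assms power_series_holomorphic[of 0 1 b f]
  by (auto simp: disc_expansion_def disc_function_def)

lemma disc_expansion_zero: "disc_expansion f b \<Longrightarrow> f 0 = b 0"
proof -
  assume "disc_expansion f b"
  then have "(\<lambda>k. b k * 0 ^ k) sums f 0"
    unfolding disc_expansion_def by (rule bspec) simp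
  then show ?thesis by (rule sums_unique2) (rule powser_sums_zero)
qed

text \<open>Dividing the remainder by z^n moves the coefficient \<open>b n\<close> to the origin,
  where it is the value of an analytic function.\<close>

lemma disc_expansion_shift:
  assumes b: "disc_expansion f b"
  obtains g where "disc_function g" "g 0 = b n"
    "\<And>z. z \<in> unit_disc \<Longrightarrow> f z = (\<Sum>k<n. b k * z ^ k) + z ^ n * g z"
proof -
  define g where "g = (\<lambda>z. if z \<in> unit_disc then (\<Sum>k. b (k + n) * z ^ k) else 0)"
  have s: "summable (\<lambda>k. b (k + n) * z ^ k)" if z: "z \<in> unit_disc" for z
  proof (cases "z = 0")
    case False
    have "summable (\<lambda>k. b k * z ^ k)"
      using b z sums_summable[of _ "f z"] by (auto simp: disc_expansion_def)
    then have "summable (\<lambda>k. b (k + n) * z ^ (k + n) / z ^ n)"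
      by (intro summable_divide summable_ignore_initial_segment)
    then show ?thesis using False by (simp add: power_add)
  qed (use powser_sums_zero[of "\<lambda>k. b (k + n)"] in \<open>auto intro: sums_summable\<close>)
  then have e: "disc_expansion g (\<lambda>k. b (k + n))"
    by (auto simp: disc_expansion_def g_def summable_sums)
  show ?thesis
  proof
    show "disc_function g" by (rule disc_expansion_function[OF e]) (auto simp: g_def)
    show "g 0 = b n" using disc_expansion_zero[OF e] by simp
    fix z :: complex assume z: "z \<in> unit_disc"
    have S: "(\<lambda>k. b k * z ^ k) sums f z" using b z by (simp add: disc_expansion_def)
    have "f z = (\<Sum>k. b (k + n) * z ^ (k + n)) + (\<Sum>k<n. b k * z ^ k)"
      using suminf_split_initial_segment[OF sums_summable[OF S], of n] sums_unique[OF S] by simp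
    also have "(\<Sum>k. b (k + n) * z ^ (k + n)) = z ^ n * (\<Sum>k. b (k + n) * z ^ k)"
      using suminf_mult[OF s[OF z], of "z ^ n"] by (simp add: power_add mult_ac)
    finally show "f z = (\<Sum>k<n. b k * z ^ k) + z ^ n * g z"
      using z by (simp add: g_def)
  qed
qed

section \<open>Moments and orthogonality of the monomials\<close>

context weighted_bergman
begin

text \<open>The squared norm of z^n, see \<open>nrm_monomial\<close>; these moments weight the
  coefficients in Parseval's identity.\<close>

definition gam :: "nat \<Rightarrow> real" where
  "gam n = (LINT z|\<mu>. norm z ^ (2 * n))"

lemma integrable_bounded_on_disc:
  fixes f :: "complex \<Rightarrow> 'b::{banach, second_countable_topology}"
  assumes [measurable]: "f \<in> borel_measurable borel" and "\<And>z. z \<in> unit_disc \<Longrightarrow> norm (f z) \<le> B"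
  shows "integrable \<mu> f"
proof (rule integrable_const_bound[where B = B])
  show "AE z in \<mu>. norm (f z) \<le> B"
    using AE_bergman_measure[OF \<alpha>] by eventually_elim (rule assms)
qed measurable

lemma integrable_norm_power: "integrable \<mu> (\<lambda>z. norm z ^ n)"
  by (rule integrable_bounded_on_disc[where B = 1]) (auto simp: power_le_one)

lemma gam_pos: "gam n > 0"
proof -
  have "(1/2 :: complex) \<in> unit_disc - {0}" by simp
  then have "unit_disc - {0} \<noteq> {}" by blast
  then show ?thesis
    unfolding gam_def
    by (intro integral_pos[where U = "unit_disc - {0}"]) (auto intro!: integrable_norm_power open_delete)
qed

lemma gam_le_1: "gam n \<le> 1"
proof -
  have "gam n \<le> (LINT z|\<mu>. 1)"
    unfolding gam_def
  proof (rule integral_mono_AE)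
    show "AE z in \<mu>. norm z ^ (2 * n) \<le> 1"
      using AE_bergman_measure[OF \<alpha>] by eventually_elim (auto simp: power_le_one)
  qed (auto intro: integrable_norm_power)
  then show ?thesis using prob_space by simp
qed

lemma nrm_monomial: "(nrm (disc_monomial n))\<^sup>2 = gam n"
proof -
  have [measurable]: "disc_monomial n \<in> borel_measurable borel"
    by (intro disc_function_measurable disc_function_monomial)
  show ?thesis
    unfolding nrm_square gam_def
  proof (rule integral_cong_AE)
  show "AE z in \<mu>. (norm (disc_monomial n z))\<^sup>2 = norm z ^ (2 * n)"
    using AE_bergman_measure[OF \<alpha>]
    by eventually_elim (auto simp: disc_monomial_def norm_power power_even_eq)
  qed measurable
qed

lemma space_of_bounded:
  assumes f: "disc_function f" and B: "\<And>z. z \<in> unit_disc \<Longrightarrow> norm (f z) \<le> B"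
  shows "f \<in> A2"
  unfolding space_iff
proof
  have [measurable]: "f \<in> borel_measurable borel" using f by (rule disc_function_measurable)
  show "integrable \<mu> (\<lambda>z. (norm (f z))\<^sup>2)"
    by (rule integrable_bounded_on_disc[where B = "B\<^sup>2"]) (auto intro!: power_mono B)
qed fact

lemma monomial_space: "disc_monomial n \<in> A2"
  by (rule space_of_bounded[OF disc_function_monomial, where B = 1])
     (auto simp: disc_monomial_def norm_power power_le_one)

lemma polynomial_space: "disc_polynomial b N \<in> A2"
  unfolding disc_polynomial_def by (intro sum_space cmult_space monomial_space)

text \<open>Since z^n times its conjugate is |z|^(2n), the inner product is an integral of g with a
  radial weight.\<close>

lemma inner_monomial_shift:
  fixes g :: "complex \<Rightarrow> complex"
  assumes g: "disc_function g" and int: "integrable \<mu> (\<lambda>z. norm z ^ (2 * n) *\<^sub>R g z)"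
  shows "ip (\<lambda>z. disc_monomial n z * g z) (disc_monomial n) = of_real (gam n) * g 0"
proof -
  have "ip (\<lambda>z. disc_monomial n z * g z) (disc_monomial n) = (LINT z|\<mu>. norm z ^ (2 * n) *\<^sub>R g z)"
    unfolding bergman_inner_def
  proof (rule Bochner_Integration.integral_cong)
    fix z
    show "disc_monomial n z * g z * cnj (disc_monomial n z) = norm z ^ (2 * n) *\<^sub>R g z"
      using g complex_norm_square[of "z ^ n"]
      by (auto simp: disc_function_def disc_monomial_def scaleR_conv_of_real norm_power power_mult mult_ac
          simp flip: power_mult)
  qed simp
  then show ?thesis
    using integral_bergman_radial[OF \<alpha> g int] by (simp add: gam_def scaleR_conv_of_real)
qed

text \<open>For n \<le> m factor z^m as z^n z^(m - n); the second factor vanishes at 0 unless m = n.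
  The other case follows by conjugate symmetry.\<close>

lemma inner_monomial: "ip (disc_monomial m) (disc_monomial n) = (if m = n then gam n else 0)"
proof -
  have *: "ip (disc_monomial m) (disc_monomial n) = (if m = n then gam n else 0)" if "n \<le> m" for m n
  proof -
    have [measurable]: "disc_monomial k \<in> borel_measurable borel" for k
      by (intro disc_function_measurable disc_function_monomial)
    have "integrable \<mu> (\<lambda>z. norm z ^ (2 * n) *\<^sub>R disc_monomial (m - n) z)"
      by (rule integrable_bounded_on_disc[where B = 1])
         (auto simp: disc_monomial_def norm_mult norm_power intro!: mult_le_one power_le_one)
    from inner_monomial_shift[OF disc_function_monomial this]
    have "ip (\<lambda>z. disc_monomial n z * disc_monomial (m - n) z) (disc_monomial n) = of_real (gam n) * disc_monomial (m - n) 0" .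
    also have "(\<lambda>z. disc_monomial n z * disc_monomial (m - n) z) = disc_monomial m"
      using that by (auto simp: disc_monomial_def simp flip: power_add)
    finally show ?thesis using that by (auto simp: disc_monomial_def)
  qed
  show ?thesis
  proof (cases "n \<le> m")
    case False
    then show ?thesis using *[of m n] inner_commute[of "disc_monomial m" "disc_monomial n"] by simp
  qed (rule *)
qed

lemma inner_polynomial_monomial:
  "ip (disc_polynomial b N) (disc_monomial n) = (if n < N then b n * gam n else 0)"
proof -
  have "ip (disc_polynomial b N) (disc_monomial n) = (\<Sum>k<N. b k * (if k = n then gam n else 0))"
    unfolding disc_polynomial_def
    by (subst inner_sum_left) (auto intro!: monomial_space simp: inner_monomial)
  also have "\<dots> = (if n < N then b n * gam n else 0)"
    by (simp add: if_distrib[of of_real] if_distrib[of "\<lambda>x. _ * x"] cong: if_cong)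
  finally show ?thesis .
qed

text \<open>The terms below degree n are orthogonal to z^n, and the remainder z^n g contributes its
  value g 0 = b n. In this way no infinite sum is interchanged with the integral.\<close>

lemma inner_monomial_expansion:
  assumes f: "f \<in> A2" and b: "disc_expansion f b"
  shows "ip f (disc_monomial n) = b n * gam n"
proof -
  obtain g where g: "disc_function g" "g 0 = b n"
    and eq: "\<And>z. z \<in> unit_disc \<Longrightarrow> f z = (\<Sum>k<n. b k * z ^ k) + z ^ n * g z"
    using disc_expansion_shift[OF b] by blast
  define r where "r = (\<lambda>z. f z - disc_polynomial b n z)"
  have r: "r \<in> A2" unfolding r_def by (intro diff_space f polynomial_space)
  have r_eq: "r = (\<lambda>z. disc_monomial n z * g z)"
    using f eq by (auto simp: r_def disc_polynomial_def disc_monomial_def space_iff disc_function_def)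
  \<comment> \<open>The remainder lies in the space, which supplies the integrability of the
    weighted g that \<open>inner_monomial_shift\<close> asks for.\<close>
  have "integrable \<mu> (\<lambda>z. r z * cnj (disc_monomial n z))"
    by (rule integrable_inner_space[OF r monomial_space])
  also have "(\<lambda>z. r z * cnj (disc_monomial n z)) = (\<lambda>z. norm z ^ (2 * n) *\<^sub>R g z)"
  proof
    fix z
    show "r z * cnj (disc_monomial n z) = norm z ^ (2 * n) *\<^sub>R g z"
      using g complex_norm_square[of "z ^ n"]
      by (auto simp: r_eq disc_function_def disc_monomial_def scaleR_conv_of_real norm_power power_mult mult_ac
          simp flip: power_mult)
  qed
  finally have "ip r (disc_monomial n) = gam n * b n"
    using inner_monomial_shift[OF g(1)] g(2) by (simp add: r_eq)
  moreover have "ip r (disc_monomial n) = ip f (disc_monomial n) - ip (disc_polynomial b n) (disc_monomial n)"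
    unfolding r_def by (intro inner_diff_left f polynomial_space monomial_space)
  ultimately show ?thesis by (simp add: inner_polynomial_monomial mult.commute)
qed
end

section \<open>Parseval, completeness and the Riesz representation\<close>

context weighted_bergman
begin

lemma inner_polynomial_left:
  "g \<in> A2 \<Longrightarrow> ip (disc_polynomial b N) g = (\<Sum>k<N. b k * ip (disc_monomial k) g)"
  unfolding disc_polynomial_def by (rule inner_sum_left) (auto intro: monomial_space)

lemma inner_polynomial_expansion:
  assumes "f \<in> A2" "disc_expansion f b"
  shows "ip (disc_polynomial c N) f = (\<Sum>k<N. c k * cnj (b k) * gam k)"
  using assms
  by (simp add: inner_polynomial_left inner_commute[of "disc_monomial _"] inner_monomial_expansion mult.assoc)

lemma nrm_polynomial: "(nrm (disc_polynomial b N))\<^sup>2 = (\<Sum>k<N. (norm (b k))\<^sup>2 * gam k)"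
proof -
  have "complex_of_real ((nrm (disc_polynomial b N))\<^sup>2) =
      (\<Sum>k<N. b k * cnj (ip (disc_polynomial b N) (disc_monomial k)))"
    unfolding inner_self[symmetric]
    by (simp add: inner_polynomial_left polynomial_space inner_commute[of "disc_monomial _"])
  also have "\<dots> = (\<Sum>k<N. complex_of_real ((norm (b k))\<^sup>2 * gam k))"
    by (intro sum.cong) (auto simp: inner_polynomial_monomial complex_norm_square mult.assoc simp del: of_real_power)
  finally show ?thesis by (simp only: of_real_sum[symmetric] of_real_eq_iff)
qed

lemma nrm_minus_polynomial:
  assumes "f \<in> A2" "disc_expansion f b"
  shows "(nrm (\<lambda>z. f z - disc_polynomial b N z))\<^sup>2 = (nrm f)\<^sup>2 - (\<Sum>k<N. (norm (b k))\<^sup>2 * gam k)"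
proof -
  have "ip (disc_polynomial b N) f = complex_of_real (\<Sum>k<N. (norm (b k))\<^sup>2 * gam k)"
    using assms by (simp add: inner_polynomial_expansion complex_norm_square del: of_real_power)
  then have "Re (ip f (disc_polynomial b N)) = (\<Sum>k<N. (norm (b k))\<^sup>2 * gam k)"
    by (subst inner_commute) simp
  then show ?thesis
    using assms by (simp add: nrm_diff_square polynomial_space nrm_polynomial)
qed

lemma bessel:
  assumes "f \<in> A2" "disc_expansion f b"
  shows "(\<Sum>k<N. (norm (b k))\<^sup>2 * gam k) \<le> (nrm f)\<^sup>2"
  using nrm_minus_polynomial[OF assms, of N] zero_le_power2[of "nrm (\<lambda>z. f z - disc_polynomial b N z)"]
  by linarith

lemma polynomial_tendsto:
  assumes "disc_expansion f b" "z \<in> unit_disc"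
  shows "(\<lambda>N. disc_polynomial b N z) \<longlonglongrightarrow> f z"
  using assms by (simp add: disc_expansion_def disc_polynomial_def disc_monomial_def sums_def)

lemma polynomial_measurable: "disc_polynomial b N \<in> borel_measurable borel"
  by (intro space_measurable polynomial_space)

text \<open>Bessel's inequality bounds the series by the squared norm. Conversely, the partial sums
  converge pointwise, so Fatou bounds the squared norm by the series.\<close>

lemma parseval:
  assumes f: "f \<in> A2" and b: "disc_expansion f b"
  shows "(\<lambda>k. (norm (b k))\<^sup>2 * gam k) sums (nrm f)\<^sup>2"
proof -
  have s: "summable (\<lambda>k. (norm (b k))\<^sup>2 * gam k)"
    using bessel[OF assms]
    by (intro summableI_nonneg_bounded[where x = "(nrm f)\<^sup>2"]) (auto simp: gam_pos less_imp_le)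
  have "(nrm f)\<^sup>2 \<le> (\<Sum>k. (norm (b k))\<^sup>2 * gam k)"
    unfolding nrm_square
  proof (rule fatou_square(2)[where U = "disc_polynomial b"])
    fix N
    show "integrable \<mu> (\<lambda>z. (norm (disc_polynomial b N z))\<^sup>2)"
      using polynomial_space[of b N] by (simp add: space_iff)
    show "(LINT z|\<mu>. (norm (disc_polynomial b N z))\<^sup>2) \<le> (\<Sum>k. (norm (b k))\<^sup>2 * gam k)"
      unfolding nrm_square[symmetric] nrm_polynomial
      by (rule sum_le_suminf[OF s]) (auto simp: gam_pos less_imp_le)
  qed (auto intro: polynomial_measurable space_measurable f polynomial_tendsto[OF b])
  moreover have "(\<Sum>k. (norm (b k))\<^sup>2 * gam k) \<le> (nrm f)\<^sup>2"
    using bessel[OF assms] by (intro suminf_le_const s) auto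
  ultimately show ?thesis using summable_sums[OF s] by simp
qed

text \<open>Density of the polynomials: the squared error is the tail of Parseval's series.\<close>

lemma nrm_minus_polynomial_tendsto:
  assumes f: "f \<in> A2" and b: "disc_expansion f b"
  shows "(\<lambda>N. nrm (\<lambda>z. f z - disc_polynomial b N z)) \<longlonglongrightarrow> 0"
proof -
  have "(\<lambda>N. (nrm f)\<^sup>2 - (\<Sum>k<N. (norm (b k))\<^sup>2 * gam k)) \<longlonglongrightarrow> (nrm f)\<^sup>2 - (nrm f)\<^sup>2"
    using parseval[OF assms] unfolding sums_def by (intro tendsto_intros)
  then have "(\<lambda>N. sqrt ((nrm (\<lambda>z. f z - disc_polynomial b N z))\<^sup>2)) \<longlonglongrightarrow> sqrt 0"
    unfolding nrm_minus_polynomial[OF assms] by (intro tendsto_real_sqrt) simp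
  then show ?thesis by (simp add: nrm_nonneg)
qed

lemma space_expansion:
  assumes "f \<in> A2"
  obtains b where "disc_expansion f b"
  using assms disc_function_expansion by (auto simp: space_iff)

text \<open>Bessel's inequality annihilates every coefficient, so f vanishes at every point of the
  disc and not just almost everywhere; outside it is 0 by convention.\<close>

lemma nrm_eq_0:
  assumes f: "f \<in> A2" and "nrm f = 0"
  shows "f z = 0"
proof (cases "z \<in> unit_disc")
  case True
  obtain b where b: "disc_expansion f b" using space_expansion[OF f] .
  have "b k = 0" for k
  proof -
    have "(\<Sum>k<Suc k. (norm (b k))\<^sup>2 * gam k) \<le> 0" using bessel[OF f b, of "Suc k"] assms(2) by simp
    moreover have "(\<Sum>k<k. (norm (b k))\<^sup>2 * gam k) \<ge> 0"
      by (intro sum_nonneg) (auto simp: gam_pos less_imp_le)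
    ultimately have "(norm (b k))\<^sup>2 * gam k \<le> 0" by simp
    then show ?thesis using gam_pos[of k] by (simp add: mult_le_0_iff)
  qed
  then have "(\<lambda>k. 0) sums f z" using b True by (simp add: disc_expansion_def)
  then show ?thesis using sums_0 sums_unique2 by blast
qed (use f in \<open>auto simp: space_iff disc_function_def\<close>)

lemma nrm_diff_eq_0:
  assumes "f \<in> A2" "g \<in> A2" "nrm (\<lambda>z. f z - g z) = 0"
  shows "f = g"
  using nrm_eq_0[OF diff_space[OF assms(1,2)] assms(3)] by auto

text \<open>The constant is the weighted measure of the annulus r < |z| < 1, on which |z|^(2n) \<ge>
  r^(2n). This will give square-summable coefficient sequences a power series converging on the
  whole disc.\<close>

lemma gam_lower_bound:
  assumes r: "0 \<le> r" "r < 1"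
  obtains c where "c > 0" "\<And>n. c * r ^ (2 * n) \<le> gam n"
proof
  define U where "U = unit_disc - cball (0::complex) r"
  have [measurable]: "U \<in> sets borel" by (simp add: U_def)
  have "complex_of_real ((1 + r) / 2) \<in> U"
    using r by (simp add: U_def del: of_real_divide of_real_add)
  then have "U \<noteq> {}" by blast
  moreover have "open U" "U \<subseteq> unit_disc" by (auto simp: U_def)
  ultimately show "(LINT z|\<mu>. indicator U z :: real) > 0"
    by (intro integral_pos[where U = U] integrable_real_indicator) (auto simp: emeasure_eq_measure)
  show "(LINT z|\<mu>. indicator U z) * r ^ (2 * n) \<le> gam n" for n
  proof -
    have "(LINT z|\<mu>. indicator U z) * r ^ (2 * n) = (LINT z|\<mu>. indicator U z * r ^ (2 * n))"
      by simp
    also have "\<dots> \<le> (LINT z|\<mu>. norm z ^ (2 * n))"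
    proof (rule integral_mono)
      show "indicator U z * r ^ (2 * n) \<le> norm z ^ (2 * n)" for z
        using r by (auto simp: U_def indicator_def intro!: power_mono)
    qed (auto intro!: integrable_norm_power integrable_real_indicator integrable_mult_left simp: emeasure_eq_measure)
    finally show ?thesis by (simp add: gam_def)
  qed
qed

text \<open>Completeness in terms of coefficients. The lower bound on the moments keeps |b n| r^n
  bounded for r < 1, so Abel's lemma gives convergence; Fatou gives square integrability.\<close>

lemma expansion_complete:
  assumes M: "\<And>N. (\<Sum>k<N. (norm (b k))\<^sup>2 * gam k) \<le> M"
  obtains h where "h \<in> A2" "disc_expansion h b"
proof -
  have bnd: "(norm (b n))\<^sup>2 * gam n \<le> M" for n
  proof -
    have "(\<Sum>k<n. (norm (b k))\<^sup>2 * gam k) \<ge> 0"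
      by (intro sum_nonneg) (auto simp: gam_pos less_imp_le)
    then show ?thesis using M[of "Suc n"] by simp
  qed
  have s: "summable (\<lambda>k. b k * z ^ k)" if z: "z \<in> unit_disc" for z
  proof -
    \<comment> \<open>A radius strictly between |z| and 1, as Abel's lemma requires.\<close>
    define r where "r = (1 + norm z) / 2"
    have r: "0 \<le> r" "r < 1" "norm z < r" using z by (auto simp: r_def)
    obtain c where c: "c > 0" "\<And>n. c * r ^ (2 * n) \<le> gam n" using gam_lower_bound[OF r(1,2)] by blast
    have "norm (b n) * r ^ n \<le> sqrt (M / c)" for n
    proof (rule real_le_rsqrt)
      have "(norm (b n))\<^sup>2 * (c * r ^ (2 * n)) \<le> M"
        by (rule order_trans[OF mult_left_mono[OF c(2)] bnd]) simp
      then have "(norm (b n))\<^sup>2 * r ^ (2 * n) \<le> M / c"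
        using c(1) by (simp add: pos_le_divide_eq mult_ac)
      then show "(norm (b n) * r ^ n)\<^sup>2 \<le> M / c"
        unfolding power_mult_distrib power_even_eq .
    qed
    then have "summable (\<lambda>n. norm (b n) * norm z ^ n)"
      using Abel_lemma[of "norm z" r b "sqrt (M / c)"] r by auto
    then show ?thesis using summable_norm_cancel[of "\<lambda>k. b k * z ^ k"] by (simp add: norm_mult norm_power)
  qed
  define h where "h = (\<lambda>z. if z \<in> unit_disc then \<Sum>k. b k * z ^ k else 0)"
  have e: "disc_expansion h b"
    using s by (auto simp: disc_expansion_def h_def summable_sums)
  have d: "disc_function h" by (rule disc_expansion_function[OF e]) (auto simp: h_def)
  have "integrable \<mu> (\<lambda>z. (norm (h z))\<^sup>2)"
  proof (rule fatou_square(1)[where U = "disc_polynomial b" and C = M])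
    fix N
    show "integrable \<mu> (\<lambda>z. (norm (disc_polynomial b N z))\<^sup>2)"
      using polynomial_space[of b N] by (simp add: space_iff)
    show "(LINT z|\<mu>. (norm (disc_polynomial b N z))\<^sup>2) \<le> M"
      unfolding nrm_square[symmetric] nrm_polynomial by (rule M)
  qed (auto intro: polynomial_measurable disc_function_measurable d polynomial_tendsto[OF e])
  with d e that show ?thesis by (auto simp: space_iff)
qed

text \<open>The values of L on monomials force the coefficients of the representing element. Testing
  L on a partial sum of norm s gives s^2 \<le> K s, hence s \<le> K, and
  \<open>expansion_complete\<close> applies. Agreement on polynomials extends by density and
  boundedness.\<close>

lemma riesz:
  assumes diff: "\<And>f g. f \<in> A2 \<Longrightarrow> g \<in> A2 \<Longrightarrow> L (\<lambda>z. f z - g z) = L f - L g"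
    and poly: "\<And>b N. L (disc_polynomial b N) = (\<Sum>k<N. b k * L (disc_monomial k))"
    and K: "\<And>f. f \<in> A2 \<Longrightarrow> norm (L f :: complex) \<le> K * nrm f"
  obtains h where "h \<in> A2" "\<And>f. f \<in> A2 \<Longrightarrow> L f = ip f h"
proof -
  \<comment> \<open>Chosen so that the inner product of z^k with the candidate,
    \<open>cnj (a k) * gam k\<close>, is the value of L at z^k.\<close>
  define a where "a k = cnj (L (disc_monomial k)) / gam k" for k
  have La: "L (disc_monomial k) = cnj (a k) * gam k" for k
    using gam_pos[of k] by (simp add: a_def)
  have "(\<Sum>k<N. (norm (a k))\<^sup>2 * gam k) \<le> K\<^sup>2" for N
  proof -
    let ?s = "\<Sum>k<N. (norm (a k))\<^sup>2 * gam k"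
    have "L (disc_polynomial a N) = of_real ?s"
      by (simp add: poly La complex_norm_square mult.assoc del: of_real_power)
    then have "norm (L (disc_polynomial a N)) = \<bar>?s\<bar>" by (simp only: norm_of_real)
    then have "?s \<le> norm (L (disc_polynomial a N))" by linarith
    also have "\<dots> \<le> K * nrm (disc_polynomial a N)" by (intro K polynomial_space)
    finally have *: "(nrm (disc_polynomial a N))\<^sup>2 \<le> K * nrm (disc_polynomial a N)"
      by (simp add: nrm_polynomial)
    show "?s \<le> K\<^sup>2"
    proof (cases "nrm (disc_polynomial a N) = 0")
      case True
      then show ?thesis using nrm_polynomial[of a N] by simp
    next
      case False
      then have "nrm (disc_polynomial a N) > 0" using nrm_nonneg[of "disc_polynomial a N"] by simp
      then have "nrm (disc_polynomial a N) \<le> K" using * by (simp add: power2_eq_square)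
      then have "(nrm (disc_polynomial a N))\<^sup>2 \<le> K\<^sup>2" by (intro power_mono nrm_nonneg)
      then show ?thesis by (simp add: nrm_polynomial)
    qed
  qed
  then obtain h where h: "h \<in> A2" "disc_expansion h a" using expansion_complete by blast
  have "L f = ip f h" if f: "f \<in> A2" for f
  proof -
    obtain b where b: "disc_expansion f b" using space_expansion[OF f] .
    define r where "r N = (\<lambda>z. f z - disc_polynomial b N z)" for N
    have r: "r N \<in> A2" for N unfolding r_def by (intro diff_space f polynomial_space)
    have eq: "L f - ip f h = L (r N) - ip (r N) h" for N
    proof -
      have "L (disc_polynomial b N) = ip (disc_polynomial b N) h"
        using h by (simp add: poly La inner_polynomial_expansion mult.assoc)
      then show ?thesis
        unfolding r_def using f h by (simp add: diff inner_diff_left polynomial_space)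
    qed
    have "norm (L f - ip f h) \<le> (K + nrm h) * nrm (r N)" for N
    proof -
      have "norm (L f - ip f h) \<le> norm (L (r N)) + norm (ip (r N) h)"
        unfolding eq[of N] by (rule norm_triangle_ineq4)
      also have "\<dots> \<le> K * nrm (r N) + nrm (r N) * nrm h"
        by (intro add_mono K r cauchy_schwarz h)
      finally show ?thesis by (simp add: algebra_simps)
    qed
    moreover have "(\<lambda>N. (K + nrm h) * nrm (r N)) \<longlonglongrightarrow> (K + nrm h) * 0"
      unfolding r_def by (intro tendsto_intros nrm_minus_polynomial_tendsto f b)
    ultimately have "norm (L f - ip f h) \<le> 0"
      by (intro LIMSEQ_le_const) auto
    then show ?thesis by simp
  qed
  with h that show ?thesis by blast
qed

text \<open>\<open>THE\<close> requires uniqueness, which holds because the difference of two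
  candidates is orthogonal to itself.\<close>

lemma adjoint_eqI:
  assumes h: "h \<in> A2" "\<And>f. f \<in> A2 \<Longrightarrow> ip (T f) g = ip f h"
  shows "bergman_adjoint \<alpha> T g = h"
  unfolding bergman_adjoint_def
proof (rule the_equality)
  fix k assume k: "k \<in> A2 \<and> (\<forall>f\<in>A2. ip (T f) g = ip f k)"
  have d: "(\<lambda>z. k z - h z) \<in> A2" using h k by (intro diff_space) auto
  have "ip (\<lambda>z. k z - h z) (\<lambda>z. k z - h z) = 0"
    using h k d by (subst inner_diff_right) auto
  then have "nrm (\<lambda>z. k z - h z) = 0" by (simp add: inner_self)
  then show "k = h" using h k nrm_diff_eq_0 by blast
qed (use h in auto)

end

section \<open>Littlewood subordination\<close>

context weighted_bergman
begin

lemma composition_disc_function: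
  assumes "f holomorphic_on unit_disc" "\<Phi> holomorphic_on unit_disc" "\<Phi> ` unit_disc \<subseteq> unit_disc"
  shows "disc_function (composition_operator \<Phi> f)"
  unfolding composition_operator_def
  using holomorphic_on_compose_gen[OF assms(2,1,3)] by (intro disc_function_extend) (simp add: o_def)

text \<open>A crude bound whose purpose is integrability, in the induction below and for the
  approximants in \<open>littlewood\<close>.\<close>

lemma composition_polynomial_bound:
  assumes "\<Phi> ` unit_disc \<subseteq> unit_disc"
  shows "norm (composition_operator \<Phi> (disc_polynomial a N) z) \<le> (\<Sum>k<N. norm (a k))"
proof (cases "z \<in> unit_disc")
  case True
  then have *: "\<Phi> z \<in> unit_disc" using assms by blast
  have "norm (\<Sum>k<N. a k * \<Phi> z ^ k) \<le> (\<Sum>k<N. norm (a k))"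
  proof (rule sum_norm_le)
    fix k
    have "norm (\<Phi> z) ^ k \<le> 1" using * by (intro power_le_one) auto
    then show "norm (a k * \<Phi> z ^ k) \<le> norm (a k)"
      by (simp add: norm_mult norm_power mult_left_le)
  qed
  with True * show ?thesis by (simp add: composition_operator_def disc_polynomial_def disc_monomial_def)
qed (auto simp: composition_operator_def intro: sum_nonneg)

text \<open>Splitting off the constant term of the polynomial and estimating the factor
  \<open>\<Phi>\<close> of the remainder by Schwarz' lemma turns the weight \<open>|z|\<^sup>2\<^sup>n\<close> into
  \<open>|z|\<^sup>2\<^sup>n\<^sup>+\<^sup>2\<close>, so the induction runs over all weights simultaneously.\<close>

lemma littlewood_polynomial:
  assumes \<Phi>: "\<Phi> holomorphic_on unit_disc" "\<Phi> ` unit_disc \<subseteq> unit_disc" "\<Phi> 0 = 0"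
  shows "(LINT z|\<mu>. norm z ^ (2 * n) * (norm (composition_operator \<Phi> (disc_polynomial a N) z))\<^sup>2)
      \<le> (\<Sum>k<N. (norm (a k))\<^sup>2 * gam (n + k))"
proof (induction N arbitrary: a n)
  case 0
  then show ?case by (simp add: disc_polynomial_def composition_operator_def)
next
  case (Suc N)
  define q where "q = composition_operator \<Phi> (disc_polynomial (\<lambda>k. a (Suc k)) N)"
  \<comment> \<open>On the disc the composed polynomial is \<open>a 0 + v\<close>, and
    \<open>v\<close> vanishes at 0 together with \<Phi>.\<close>
  define v where "v = (\<lambda>z. if z \<in> unit_disc then \<Phi> z * q z else 0)"
  define B where "B = (\<Sum>k<N. norm (a (Suc k)))"
  have q: "disc_function q"
    unfolding q_def using polynomial_space \<Phi>
    by (intro composition_disc_function) (auto simp: space_iff disc_function_def)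
  have v: "disc_function v"
    unfolding v_def using q \<Phi> by (intro disc_function_extend holomorphic_intros) (auto simp: disc_function_def)
  have [measurable]: "q \<in> borel_measurable borel" "v \<in> borel_measurable borel"
    using q v by (auto intro: disc_function_measurable)
  have qB: "norm (q z) \<le> B" for z unfolding q_def B_def by (rule composition_polynomial_bound) fact
  have schwarz: "norm (\<Phi> z) \<le> norm z" if "z \<in> unit_disc" for z
    using Schwarz_Lemma(1)[of \<Phi> z] \<Phi> that by (auto simp: image_subset_iff)
  have vq: "norm (v z) \<le> norm z * norm (q z)" for z
    using schwarz[of z] by (auto simp: v_def norm_mult intro: mult_right_mono)
  have vB: "norm (v z) \<le> B" if "z \<in> unit_disc" for z
  proof -
    have "norm (v z) \<le> 1 * norm (q z)"
      using vq[of z] that by (elim order_trans) (intro mult_right_mono, auto)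
    with qB[of z] show ?thesis by simp
  qed
  have le1: "norm z ^ m \<le> 1" if "z \<in> unit_disc" for z :: complex and m
    using that by (auto intro: power_le_one)
  have iv: "integrable \<mu> (\<lambda>z. norm z ^ (2 * n) *\<^sub>R v z)"
  proof (rule integrable_bounded_on_disc)
    fix z assume "z \<in> unit_disc"
    then have "norm z ^ (2 * n) * norm (v z) \<le> 1 * B" by (intro mult_mono vB le1) auto
    then show "norm (norm z ^ (2 * n) *\<^sub>R v z) \<le> 1 * B" by simp
  qed measurable
  have iv2: "integrable \<mu> (\<lambda>z. norm z ^ (2 * n) * (norm (v z))\<^sup>2)"
  proof (rule integrable_bounded_on_disc)
    fix z assume "z \<in> unit_disc"
    then have "norm z ^ (2 * n) * (norm (v z))\<^sup>2 \<le> 1 * B\<^sup>2" by (intro mult_mono power_mono vB le1) auto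
    then show "norm (norm z ^ (2 * n) * (norm (v z))\<^sup>2) \<le> 1 * B\<^sup>2" by simp
  qed measurable
  have iq2: "integrable \<mu> (\<lambda>z. norm z ^ (2 * Suc n) * (norm (q z))\<^sup>2)"
  proof (rule integrable_bounded_on_disc)
    fix z :: complex assume "z \<in> unit_disc"
    then have "norm z ^ (2 * Suc n) * (norm (q z))\<^sup>2 \<le> 1 * B\<^sup>2" by (intro mult_mono power_mono qB le1) auto
    then show "norm (norm z ^ (2 * Suc n) * (norm (q z))\<^sup>2) \<le> 1 * B\<^sup>2" by (simp del: mult_Suc_right)
  qed measurable
  have "v 0 = 0" using \<Phi> by (simp add: v_def)
  with integral_bergman_radial[OF \<alpha> v iv] have v0: "(LINT z|\<mu>. norm z ^ (2 * n) *\<^sub>R v z) = 0" by simp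
  \<comment> \<open>The real part of \<open>R\<close> is the weighted cross term of |a 0 + v|^2. It
    integrates to 0 because the weight is radial and v 0 = 0.\<close>
  define R where "R = (\<lambda>z. 2 * cnj (a 0) * (norm z ^ (2 * n) *\<^sub>R v z))"
  have iR: "integrable \<mu> R" unfolding R_def using iv by (rule integrable_mult_right)
  have "(LINT z|\<mu>. R z) = 0" unfolding R_def using v0 by (subst integral_mult_right_zero) simp
  with integral_Re[OF iR] have R0: "(LINT z|\<mu>. Re (R z)) = 0" by simp
  have "(LINT z|\<mu>. norm z ^ (2 * n) * (norm (composition_operator \<Phi> (disc_polynomial a (Suc N)) z))\<^sup>2) =
     (LINT z|\<mu>. (norm (a 0))\<^sup>2 * norm z ^ (2 * n) + Re (R z) +
        norm z ^ (2 * n) * (norm (v z))\<^sup>2)"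
  proof (rule integral_cong_AE)
    show "AE z in \<mu>. norm z ^ (2 * n) * (norm (composition_operator \<Phi> (disc_polynomial a (Suc N)) z))\<^sup>2 =
       (norm (a 0))\<^sup>2 * norm z ^ (2 * n) + Re (R z) +
        norm z ^ (2 * n) * (norm (v z))\<^sup>2"
      using AE_bergman_measure[OF \<alpha>]
    proof eventually_elim
      case (elim z)
      then have "\<Phi> z \<in> unit_disc" using \<Phi>(2) by blast
      with elim have "composition_operator \<Phi> (disc_polynomial a (Suc N)) z = a 0 + v z"
        by (simp add: composition_operator_def disc_polynomial_def disc_monomial_def v_def q_def
            sum.lessThan_Suc_shift sum_distrib_left mult_ac del: sum.lessThan_Suc)
      moreover have "(norm (a 0 + v z))\<^sup>2 = (norm (a 0))\<^sup>2 + Re (2 * cnj (a 0) * v z) + (norm (v z))\<^sup>2"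
        unfolding cmod_power2 by (simp add: power2_eq_square algebra_simps)
      ultimately show ?case by (simp add: R_def algebra_simps)
    qed
    have "composition_operator \<Phi> (disc_polynomial a (Suc N)) \<in> borel_measurable borel"
      using polynomial_space \<Phi>
      by (intro disc_function_measurable composition_disc_function) (auto simp: space_iff disc_function_def)
    then show "(\<lambda>z. norm z ^ (2 * n) * (norm (composition_operator \<Phi> (disc_polynomial a (Suc N)) z))\<^sup>2)
        \<in> borel_measurable \<mu>" by measurable
  qed (auto simp: R_def)
  also have "\<dots> = (norm (a 0))\<^sup>2 * gam n + (LINT z|\<mu>. norm z ^ (2 * n) * (norm (v z))\<^sup>2)"
    using iR iv2 integrable_norm_power[of "2 * n"] R0 by (simp add: gam_def)
  also have "(LINT z|\<mu>. norm z ^ (2 * n) * (norm (v z))\<^sup>2) \<le>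
      (LINT z|\<mu>. norm z ^ (2 * Suc n) * (norm (q z))\<^sup>2)"
  proof (rule integral_mono[OF iv2 iq2])
    fix z
    have "norm z ^ (2 * n) * (norm (v z))\<^sup>2 \<le> norm z ^ (2 * n) * (norm z * norm (q z))\<^sup>2"
      by (intro mult_left_mono power_mono vq) auto
    then show "norm z ^ (2 * n) * (norm (v z))\<^sup>2 \<le> norm z ^ (2 * Suc n) * (norm (q z))\<^sup>2"
      by (simp add: power_mult_distrib power2_eq_square mult_ac)
  qed
  also have "\<dots> \<le> (\<Sum>k<N. (norm (a (Suc k)))\<^sup>2 * gam (Suc n + k))"
    unfolding q_def by (rule Suc.IH)
  finally show ?case
    by (simp add: sum.lessThan_Suc_shift del: sum.lessThan_Suc)
qed

text \<open>The polynomial estimate with n = 0 and Bessel's inequality bound the composed partial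
  sums by the norm of f; Fatou passes to the limit.\<close>

lemma littlewood:
  assumes \<Phi>: "\<Phi> holomorphic_on unit_disc" "\<Phi> ` unit_disc \<subseteq> unit_disc" "\<Phi> 0 = 0" and f: "f \<in> A2"
  shows "composition_operator \<Phi> f \<in> A2" "nrm (composition_operator \<Phi> f) \<le> nrm f"
proof -
  obtain b where b: "disc_expansion f b" using space_expansion[OF f] .
  let ?U = "\<lambda>N. composition_operator \<Phi> (disc_polynomial b N)"
  have d: "disc_function (composition_operator \<Phi> f)"
    using f \<Phi> by (intro composition_disc_function) (auto simp: space_iff disc_function_def)
  have U: "disc_function (?U N)" for N
    using \<Phi> polynomial_space by (intro composition_disc_function) (auto simp: space_iff disc_function_def)
  have lim: "(\<lambda>N. ?U N z) \<longlonglongrightarrow> composition_operator \<Phi> f z" if "z \<in> unit_disc" for z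
  proof -
    have "\<Phi> z \<in> unit_disc" using that \<Phi>(2) by blast
    then show ?thesis using polynomial_tendsto[OF b, of "\<Phi> z"] that by (simp add: composition_operator_def)
  qed
  have int: "integrable \<mu> (\<lambda>z. (norm (?U N z))\<^sup>2)" for N
    using space_of_bounded[OF U composition_polynomial_bound[OF \<Phi>(2)]] by (simp add: space_iff)
  have le: "(LINT z|\<mu>. (norm (?U N z))\<^sup>2) \<le> (nrm f)\<^sup>2" for N
    using littlewood_polynomial[OF \<Phi>, of 0 b N] bessel[OF f b, of N] by simp
  note * = fatou_square[OF disc_function_measurable[OF U] disc_function_measurable[OF d] lim int le]
  show "composition_operator \<Phi> f \<in> A2" using d *(1) by (simp add: space_iff)
  have "(nrm (composition_operator \<Phi> f))\<^sup>2 \<le> (nrm f)\<^sup>2" using *(2) by (simp add: nrm_square)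
  then show "nrm (composition_operator \<Phi> f) \<le> nrm f"
    by (rule power2_le_imp_le) (rule nrm_nonneg)
qed
end

section \<open>Boundedness of composition operators\<close>

lemma Moebius_function_image:
  assumes "norm w < 1"
  shows "Moebius_function 0 w ` unit_disc = unit_disc"
proof (intro equalityI subsetI)
  fix z assume z: "z \<in> unit_disc"
  then have "Moebius_function 0 w (Moebius_function 0 (-w) z) = z"
    using assms by (intro Moebius_function_compose) auto
  moreover have "Moebius_function 0 (-w) z \<in> unit_disc"
    using Moebius_function_norm_lt_1[of "-w" z 0] assms z by simp
  ultimately show "z \<in> Moebius_function 0 w ` unit_disc" by (metis imageI)
qed (use assms Moebius_function_norm_lt_1 in auto)

lemma Moebius_function_inj:
  assumes "norm w < 1"
  shows "inj_on (Moebius_function 0 w) unit_disc"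
proof (rule inj_on_inverseI)
  fix z assume "z \<in> unit_disc"
  then show "Moebius_function 0 (-w) (Moebius_function 0 w z) = z"
    using assms by (intro Moebius_function_compose) auto
qed

definition moebius_deriv :: "complex \<Rightarrow> complex \<Rightarrow> complex" where
  "moebius_deriv w z = of_real (1 - (norm w)\<^sup>2) / (1 - cnj w * z)\<^sup>2"

lemma moebius_denom_nonzero:
  assumes "norm w < 1" "norm z < 1"
  shows "1 - cnj w * z \<noteq> 0"
proof
  assume "1 - cnj w * z = 0"
  then have "norm (cnj w * z) = 1" by (metis norm_one right_minus_eq)
  moreover have "norm w * norm z < 1 * 1" using assms by (intro mult_strict_mono) auto
  ultimately show False by (simp add: norm_mult)
qed

lemma Moebius_function_has_field_derivative:
  assumes "norm w < 1" "norm z < 1"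
  shows "(Moebius_function 0 w has_field_derivative moebius_deriv w z) (at z)"
proof -
  note nz = moebius_denom_nonzero[OF assms]
  have "((\<lambda>z. (z - w) / (1 - cnj w * z)) has_field_derivative
     (1 * (1 - cnj w * z) - (z - w) * (- cnj w)) / ((1 - cnj w * z) * (1 - cnj w * z))) (at z)"
    using nz by (auto intro!: derivative_eq_intros)
  also have "(1 * (1 - cnj w * z) - (z - w) * (- cnj w)) / ((1 - cnj w * z) * (1 - cnj w * z)) = moebius_deriv w z"
  proof -
    have "complex_of_real (1 - (norm w)\<^sup>2) = 1 - w * cnj w"
      by (simp add: complex_norm_square del: of_real_power)
    then show ?thesis
      unfolding moebius_deriv_def by (simp only:) (simp add: power2_eq_square algebra_simps)
  qed
  also have "(\<lambda>z. (z - w) / (1 - cnj w * z)) = Moebius_function 0 w"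
    by (simp add: Moebius_function_simple fun_eq_iff)
  finally show ?thesis .
qed

text \<open>Equality in the Schwarz-Pick inequality, from |1 - cnj w z|^2 - |z - w|^2 = (1 - |z|^2)
  (1 - |w|^2). Consequently the Moebius substitution multiplies the weight by
  |derivative|^\<alpha>.\<close>

lemma one_minus_norm_Moebius:
  assumes "norm w < 1" "norm z < 1"
  shows "1 - (norm (Moebius_function 0 w z))\<^sup>2 = (1 - (norm z)\<^sup>2) * norm (moebius_deriv w z)"
proof -
  note nz = moebius_denom_nonzero[OF assms]
  have w: "(norm w)\<^sup>2 < 1" using assms by (simp add: abs_square_less_1)
  have "complex_of_real ((norm (1 - cnj w * z))\<^sup>2 - (norm (z - w))\<^sup>2) =
        of_real ((1 - (norm z)\<^sup>2) * (1 - (norm w)\<^sup>2))"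
    by (simp add: complex_norm_square algebra_simps del: of_real_power)
  then have "(norm (1 - cnj w * z))\<^sup>2 - (norm (z - w))\<^sup>2 = (1 - (norm z)\<^sup>2) * (1 - (norm w)\<^sup>2)"
    by (simp only: of_real_eq_iff)
  moreover have "norm (moebius_deriv w z) = (1 - (norm w)\<^sup>2) / (norm (1 - cnj w * z))\<^sup>2"
    using w unfolding moebius_deriv_def norm_divide norm_power norm_of_real by simp
  moreover have "1 - (norm (Moebius_function 0 w z))\<^sup>2 =
      ((norm (1 - cnj w * z))\<^sup>2 - (norm (z - w))\<^sup>2) / (norm (1 - cnj w * z))\<^sup>2"
    unfolding Moebius_function_simple norm_divide power_divide
    by (subst diff_divide_distrib) (use nz in simp)
  ultimately show ?thesis by simp
qed

text \<open>From |1 - cnj w z| \<le> 2. Uniformity in z is what yields a constant in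
  \<open>composition_moebius\<close>.\<close>

lemma moebius_deriv_lower_bound:
  assumes "norm w < 1" "norm z < 1"
  shows "(1 - (norm w)\<^sup>2) / 4 \<le> norm (moebius_deriv w z)"
proof -
  have w: "(norm w)\<^sup>2 < 1" using assms by (simp add: abs_square_less_1)
  have "norm w * norm z \<le> 1 * 1" using assms by (intro mult_mono) auto
  then have "norm (1 - cnj w * z) \<le> 2"
    using norm_triangle_ineq4[of 1 "cnj w * z"] by (simp add: norm_mult)
  then have "(norm (1 - cnj w * z))\<^sup>2 \<le> 2\<^sup>2" by (intro power_mono) auto
  moreover have "0 < (norm (1 - cnj w * z))\<^sup>2" using moebius_denom_nonzero[OF assms] by simp
  ultimately have "(1 - (norm w)\<^sup>2) / 4 \<le> (1 - (norm w)\<^sup>2) / (norm (1 - cnj w * z))\<^sup>2"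
    using w by (intro divide_left_mono) auto
  then show ?thesis
    using w unfolding moebius_deriv_def norm_divide norm_power norm_of_real by simp
qed

context weighted_bergman
begin

text \<open>Substituting the Moebius map \<phi> in the norm integral of f gives the norm integral of
  the composition with an extra factor |\<phi>'|^(\<alpha> + 2): the exponent 2 is the Jacobian,
  \<alpha> comes from the weight. This factor is bounded below.\<close>

lemma composition_moebius:
  assumes w: "norm w < 1"
  obtains K where "K \<ge> 0" "\<And>f. f \<in> A2 \<Longrightarrow> composition_operator (Moebius_function 0 w) f \<in> A2"
    "\<And>f. f \<in> A2 \<Longrightarrow> nrm (composition_operator (Moebius_function 0 w) f) \<le> K * nrm f"
proof -
  define \<phi> where "\<phi> = Moebius_function 0 w"
  define m where "m = (1 - (norm w)\<^sup>2) / 4"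
  define W where "W = bergman_density \<alpha>"
  have [measurable]: "W \<in> borel_measurable borel" unfolding W_def by measurable
  have W0: "W z \<ge> 0" for z unfolding W_def by (rule bergman_density_nonneg[OF \<alpha>])
  have m: "m > 0" using w by (simp add: m_def abs_square_less_1)
  \<comment> \<open>The reciprocal of m^(\<alpha> + 2), the lower bound of the extra factor; it uses
    |\<phi>'| \<ge> m and \<alpha> + 2 > 0.\<close>
  define C where "C = (1 / m) powr (\<alpha> + 2)"
  have C: "C \<ge> 0" by (simp add: C_def)
  have img: "\<phi> ` unit_disc = unit_disc" unfolding \<phi>_def by (rule Moebius_function_image[OF w])
  have hol: "\<phi> holomorphic_on unit_disc" unfolding \<phi>_def using w by (rule Moebius_function_holomorphic)
  have [measurable]: "moebius_deriv w \<in> borel_measurable borel"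
    unfolding moebius_deriv_def by measurable
  have density: "W z \<le> C * ((norm (moebius_deriv w z))\<^sup>2 * W (\<phi> z))" if z: "z \<in> unit_disc" for z
  proof -
    let ?d = "norm (moebius_deriv w z)"
    have \<phi>z: "\<phi> z \<in> unit_disc" using img z by blast
    have d: "m \<le> ?d" "?d > 0" using moebius_deriv_lower_bound[of w z] w z m by (auto simp: m_def)
    have z1: "1 - (norm z)\<^sup>2 > 0" using z by (simp add: abs_square_less_1)
    have "1 - (norm (\<phi> z))\<^sup>2 = (1 - (norm z)\<^sup>2) * ?d"
      unfolding \<phi>_def using one_minus_norm_Moebius[of w z] w z by simp
    then have "W (\<phi> z) = W z * ?d powr \<alpha>"
      using z \<phi>z z1 d by (simp add: W_def bergman_density_def powr_mult)
    then have "?d\<^sup>2 * W (\<phi> z) = W z * ?d powr (\<alpha> + 2)"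
      using d by (simp add: powr_add)
    moreover have "1 \<le> C * ?d powr (\<alpha> + 2)"
    proof -
      have "1 \<le> (1 / m * ?d) powr (\<alpha> + 2)"
        using d m \<alpha> by (intro ge_one_powr_ge_zero) (auto simp: field_simps)
      then show ?thesis using d m by (simp add: C_def powr_mult powr_divide)
    qed
    ultimately show ?thesis
      using mult_left_mono[OF \<open>1 \<le> C * ?d powr (\<alpha> + 2)\<close> W0[of z]] by (simp add: mult_ac)
  qed
  have main: "composition_operator \<phi> f \<in> A2 \<and> (nrm (composition_operator \<phi> f))\<^sup>2 \<le> C * (nrm f)\<^sup>2"
    if f: "f \<in> A2" for f
  proof -
    define g where "g = composition_operator \<phi> f"
    have g: "disc_function g"
      unfolding g_def using f hol img by (intro composition_disc_function) (auto simp: space_iff disc_function_def)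
    have [measurable]: "f \<in> borel_measurable borel" "g \<in> borel_measurable borel"
      using f g by (auto intro: space_measurable disc_function_measurable)
    define H where "H = (\<lambda>u. complex_of_real (W u * (norm (f u))\<^sup>2))"
    have [measurable]: "H \<in> borel_measurable borel" unfolding H_def by measurable
    have supp: "indicator unit_disc u *\<^sub>R H u = H u" for u
      by (simp add: H_def W_def bergman_density_def indicator_def)
    have f2: "integrable lborel (\<lambda>u. W u * (norm (f u))\<^sup>2)"
      using f integrable_bergman_measure_iff[OF \<alpha>, of "\<lambda>z. (norm (f z))\<^sup>2"] by (simp add: space_iff W_def)
    have H: "integrable lborel (\<lambda>u. indicator (\<phi> ` unit_disc) u *\<^sub>R H u)"
      unfolding img supp unfolding H_def using f2 by (rule integrable_of_real)
    define P where "P = (\<lambda>z. indicator unit_disc z * ((norm (moebius_deriv w z))\<^sup>2 * (W (\<phi> z) * (norm (g z))\<^sup>2)))"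
    have P_eq: "indicator unit_disc z *\<^sub>R ((norm (moebius_deriv w z))\<^sup>2 *\<^sub>R H (\<phi> z)) = complex_of_real (P z)" for z
      by (auto simp: P_def H_def g_def composition_operator_def indicator_def scaleR_conv_of_real)
    have \<phi>_meas: "(\<lambda>z. indicator unit_disc z *\<^sub>R \<phi> z) \<in> borel_measurable borel"
      by (intro borel_measurable_continuous_on_indicator holomorphic_on_imp_continuous_on hol) auto
    \<comment> \<open>Under the outer indicator \<phi> may be replaced by its zero extension, which
      is Borel measurable on the plane.\<close>
    have P_alt: "P = (\<lambda>z. indicator unit_disc z * ((norm (moebius_deriv w z))\<^sup>2 *
          (W (indicator unit_disc z *\<^sub>R \<phi> z) * (norm (g z))\<^sup>2)))"
      by (auto simp: P_def indicator_def)
    have [measurable]: "P \<in> borel_measurable borel"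
      unfolding P_alt using \<phi>_meas by measurable
    have der: "(\<phi> has_field_derivative moebius_deriv w z) (at z)" if "z \<in> unit_disc" for z
      unfolding \<phi>_def using that w by (intro Moebius_function_has_field_derivative) auto
    have inj: "inj_on \<phi> unit_disc" unfolding \<phi>_def by (rule Moebius_function_inj[OF w])
    have m1: "(\<lambda>u. indicator (\<phi> ` unit_disc) u *\<^sub>R H u) \<in> borel_measurable borel"
      unfolding img by measurable
    have m2: "(\<lambda>z. indicator unit_disc z *\<^sub>R ((norm (moebius_deriv w z))\<^sup>2 *\<^sub>R H (\<phi> z))) \<in> borel_measurable borel"
      unfolding P_eq by measurable
    note cov = complex_change_of_variables[OF unit_disc_borel der inj m1 m2 H, unfolded P_eq]
    have P: "integrable lborel P"
      using integrable_Re[OF cov(1)] by simp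
    have PI: "(LINT z|lborel. P z) = (nrm f)\<^sup>2"
    proof -
      have "(LINT z|lborel. complex_of_real (P z)) = (LINT u|lborel. complex_of_real (W u * (norm (f u))\<^sup>2))"
        using cov(2) unfolding img supp by (simp add: H_def)
      then have "(LINT z|lborel. P z) = (LINT u|lborel. W u * (norm (f u))\<^sup>2)"
        by (simp only: integral_complex_of_real of_real_eq_iff)
      also have "\<dots> = (nrm f)\<^sup>2"
        using integral_bergman_measure[OF \<alpha>, of "\<lambda>z. (norm (f z))\<^sup>2"] by (simp add: nrm_square W_def)
      finally show ?thesis .
    qed
    have le: "W z * (norm (g z))\<^sup>2 \<le> C * P z" for z
    proof (cases "z \<in> unit_disc")
      case True
      then show ?thesis
        using mult_right_mono[OF density[OF True], of "(norm (g z))\<^sup>2"] by (simp add: P_def mult_ac)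
    qed (simp add: W_def bergman_density_def P_def)
    have i: "integrable lborel (\<lambda>z. W z * (norm (g z))\<^sup>2)"
    proof (rule Bochner_Integration.integrable_bound)
      show "integrable lborel (\<lambda>z. C * P z)" using P by simp
      show "AE z in lborel. norm (W z * (norm (g z))\<^sup>2) \<le> norm (C * P z)"
      proof (rule AE_I2)
        fix z
        have "0 \<le> W z * (norm (g z))\<^sup>2" using W0 by simp
        then show "norm (W z * (norm (g z))\<^sup>2) \<le> norm (C * P z)" using le[of z] by simp
      qed
    qed measurable
    then have "integrable \<mu> (\<lambda>z. (norm (g z))\<^sup>2)"
      using integrable_bergman_measure_iff[OF \<alpha>, of "\<lambda>z. (norm (g z))\<^sup>2"] by (simp add: W_def)
    moreover have "(nrm g)\<^sup>2 \<le> C * (nrm f)\<^sup>2"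
    proof -
      have "(nrm g)\<^sup>2 = (LINT z|lborel. W z * (norm (g z))\<^sup>2)"
        using integral_bergman_measure[OF \<alpha>, of "\<lambda>z. (norm (g z))\<^sup>2"] by (simp add: nrm_square W_def)
      also have "\<dots> \<le> (LINT z|lborel. C * P z)"
        using i P le by (intro integral_mono) auto
      finally show ?thesis by (simp add: PI)
    qed
    ultimately show ?thesis using g by (simp add: g_def space_iff)
  qed
  show ?thesis
  proof (rule that[of "sqrt C"])
    show "nrm (composition_operator (Moebius_function 0 w) f) \<le> sqrt C * nrm f" if "f \<in> A2" for f
    proof (rule power2_le_imp_le)
      show "(nrm (composition_operator (Moebius_function 0 w) f))\<^sup>2 \<le> (sqrt C * nrm f)\<^sup>2"
        using main[OF that] C by (simp add: \<phi>_def power_mult_distrib)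
    qed (use C nrm_nonneg in simp)
  qed (use C main in \<open>auto simp: \<phi>_def\<close>)
qed

text \<open>Composition operators reverse the order of the maps: the Moebius operator acts first and
  the subordination contraction second, so K is the Moebius constant.\<close>

lemma composition_bounded:
  assumes \<Phi>: "\<Phi> holomorphic_on unit_disc" "\<Phi> ` unit_disc \<subseteq> unit_disc"
  obtains K where "\<And>f. f \<in> A2 \<Longrightarrow> composition_operator \<Phi> f \<in> A2"
    "\<And>f. f \<in> A2 \<Longrightarrow> nrm (composition_operator \<Phi> f) \<le> K * nrm f"
proof -
  define w where "w = \<Phi> 0"
  have w: "norm w < 1" using \<Phi>(2) by (auto simp: w_def image_subset_iff)
  define \<Phi>\<^sub>0 where "\<Phi>\<^sub>0 = Moebius_function 0 w \<circ> \<Phi>"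
  have \<Phi>\<^sub>0: "\<Phi>\<^sub>0 holomorphic_on unit_disc" "\<Phi>\<^sub>0 ` unit_disc \<subseteq> unit_disc" "\<Phi>\<^sub>0 0 = 0"
    using holomorphic_on_compose_gen[OF \<Phi>(1) Moebius_function_holomorphic[OF w] \<Phi>(2)]
      Moebius_function_image[OF w] \<Phi>(2)
    by (auto simp: \<Phi>\<^sub>0_def w_def Moebius_function_eq_zero image_subset_iff)
  have eq: "composition_operator \<Phi> f =
      composition_operator \<Phi>\<^sub>0 (composition_operator (Moebius_function 0 (-w)) f)" for f
  proof
    fix z
    show "composition_operator \<Phi> f z =
      composition_operator \<Phi>\<^sub>0 (composition_operator (Moebius_function 0 (-w)) f) z"
    proof (cases "z \<in> unit_disc")
      case True
      have "\<Phi> z \<in> unit_disc" "\<Phi>\<^sub>0 z \<in> unit_disc" using True \<Phi>(2) \<Phi>\<^sub>0(2) by blast+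
      moreover from this have "Moebius_function 0 (-w) (\<Phi>\<^sub>0 z) = \<Phi> z"
        unfolding \<Phi>\<^sub>0_def o_def using w by (intro Moebius_function_compose) auto
      ultimately show ?thesis using True by (simp add: composition_operator_def)
    qed (simp add: composition_operator_def)
  qed
  obtain K where K: "K \<ge> 0" "\<And>f. f \<in> A2 \<Longrightarrow> composition_operator (Moebius_function 0 (-w)) f \<in> A2"
    "\<And>f. f \<in> A2 \<Longrightarrow> nrm (composition_operator (Moebius_function 0 (-w)) f) \<le> K * nrm f"
    using composition_moebius[of "-w"] w by auto
  show ?thesis
  proof
    fix f assume f: "f \<in> A2"
    show "composition_operator \<Phi> f \<in> A2"
      unfolding eq by (intro littlewood(1) \<Phi>\<^sub>0 K f)
    show "nrm (composition_operator \<Phi> f) \<le> K * nrm f"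
      unfolding eq by (rule order_trans[OF littlewood(2)[OF \<Phi>\<^sub>0 K(2)[OF f]] K(3)[OF f]])
  qed
qed

text \<open>Boundedness and Cauchy-Schwarz make the pairing of the composed f with g a bounded
  functional of f; its Riesz representer is what \<open>THE\<close> in
  \<open>bergman_adjoint\<close> selects.\<close>

lemma composition_adjoint:
  assumes \<Phi>: "\<Phi> holomorphic_on unit_disc" "\<Phi> ` unit_disc \<subseteq> unit_disc" and g: "g \<in> A2"
  shows "bergman_adjoint \<alpha> (composition_operator \<Phi>) g \<in> A2"
    and "f \<in> A2 \<Longrightarrow> ip f (bergman_adjoint \<alpha> (composition_operator \<Phi>) g) = ip (composition_operator \<Phi> f) g"
proof -
  let ?C = "composition_operator \<Phi>"
  obtain K where K: "\<And>f. f \<in> A2 \<Longrightarrow> ?C f \<in> A2" "\<And>f. f \<in> A2 \<Longrightarrow> nrm (?C f) \<le> K * nrm f"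
    using composition_bounded[OF \<Phi>] by blast
  obtain h where h: "h \<in> A2" "\<And>f. f \<in> A2 \<Longrightarrow> ip (?C f) g = ip f h"
  proof (rule riesz[of "\<lambda>f. ip (?C f) g" "K * nrm g"])
    fix f1 f2 assume "f1 \<in> A2" "f2 \<in> A2"
    moreover have "?C (\<lambda>z. f1 z - f2 z) = (\<lambda>z. ?C f1 z - ?C f2 z)"
      by (auto simp: composition_operator_def)
    ultimately show "ip (?C (\<lambda>z. f1 z - f2 z)) g = ip (?C f1) g - ip (?C f2) g"
      using K(1) g by (simp add: inner_diff_left)
  next
    fix b N
    have "?C (disc_polynomial b N) = (\<lambda>z. \<Sum>k<N. b k * ?C (disc_monomial k) z)"
      by (auto simp: composition_operator_def disc_polynomial_def)
    then show "ip (?C (disc_polynomial b N)) g = (\<Sum>k<N. b k * ip (?C (disc_monomial k)) g)"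
      using K(1)[OF monomial_space] g by (simp add: inner_sum_left)
  next
    fix f assume f: "f \<in> A2"
    have "norm (ip (?C f) g) \<le> nrm (?C f) * nrm g"
      by (intro cauchy_schwarz K f g)
    also have "\<dots> \<le> (K * nrm f) * nrm g"
      by (intro mult_right_mono K f nrm_nonneg)
    finally show "norm (ip (?C f) g) \<le> K * nrm g * nrm f" by (simp add: mult_ac)
  qed blast
  then have "bergman_adjoint \<alpha> ?C g = h" by (rule adjoint_eqI)
  then show "bergman_adjoint \<alpha> ?C g \<in> A2"
    "f \<in> A2 \<Longrightarrow> ip f (bergman_adjoint \<alpha> ?C g) = ip (?C f) g"
    using h by auto
qed
end

section \<open>Isometries and rotations\<close>

text \<open>The alternatives are the equality cases of Schwarz' lemma; below, \<Psi> meets the first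
  and \<Phi> the second.\<close>

lemma disc_rotationI:
  assumes "\<Phi> holomorphic_on unit_disc" "\<Phi> ` unit_disc \<subseteq> unit_disc" "\<Phi> 0 = 0"
    and "(\<exists>z. norm z < 1 \<and> z \<noteq> 0 \<and> norm (\<Phi> z) = norm z) \<or> norm (deriv \<Phi> 0) = 1"
  shows "disc_rotation \<Phi>"
  using Schwarz_Lemma(3)[of \<Phi> 0] assms by (auto simp: disc_rotation_def image_subset_iff)

context weighted_bergman
begin

text \<open>The constant 1 is the reproducing kernel at the origin, as \<open>gam 0\<close> is the
  total mass 1.\<close>

lemma inner_monomial_0:
  assumes "f \<in> A2"
  shows "ip f (disc_monomial 0) = f 0"
proof -
  obtain b where b: "disc_expansion f b" using space_expansion[OF assms] .
  have "gam 0 = 1" using prob_space by (simp add: gam_def)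
  then show ?thesis
    using inner_monomial_expansion[OF assms b, of 0] disc_expansion_zero[OF b] by simp
qed

section \<open>Composition with rotations\<close>

lemma rotation_space:
  assumes f: "f \<in> A2" and \<zeta>: "norm \<zeta> = 1"
  shows "(\<lambda>z. f (\<zeta> * z)) \<in> A2" "nrm (\<lambda>z. f (\<zeta> * z)) = nrm f"
proof -
  have [measurable]: "f \<in> borel_measurable borel" using f by (rule space_measurable)
  have rot: "distr \<mu> borel ((*) \<zeta>) = \<mu>" by (rule bergman_measure_rotation[OF \<alpha> \<zeta>])
  have hol: "f holomorphic_on unit_disc" using f by (simp add: space_iff disc_function_def)
  have "(\<lambda>z. f (\<zeta> * z)) holomorphic_on unit_disc"
    using \<zeta> by (intro holomorphic_on_compose_gen[of "\<lambda>z. \<zeta> * z" _ f unit_disc, unfolded o_def] hol)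
      (auto intro!: holomorphic_intros simp: norm_mult)
  then have "disc_function (\<lambda>z. f (\<zeta> * z))"
    using f \<zeta> by (auto simp: space_iff disc_function_def norm_mult)
  moreover have "integrable \<mu> (\<lambda>z. (norm (f (\<zeta> * z)))\<^sup>2)"
    using integrable_distr_eq[of "(*) \<zeta>" \<mu> borel "\<lambda>z. (norm (f z))\<^sup>2"] f rot by (simp add: space_iff)
  ultimately show "(\<lambda>z. f (\<zeta> * z)) \<in> A2" by (simp add: space_iff)
  show "nrm (\<lambda>z. f (\<zeta> * z)) = nrm f"
    using integral_distr[of "(*) \<zeta>" \<mu> borel "\<lambda>z. (norm (f z))\<^sup>2"] rot by (simp add: bergman_norm_def)
qed

lemma inner_rotation:
  assumes f: "f \<in> A2" and g: "g \<in> A2" and \<zeta>: "norm \<zeta> = 1"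
  shows "ip (\<lambda>z. f (\<zeta> * z)) (\<lambda>z. g (\<zeta> * z)) = ip f g"
proof -
  have [measurable]: "f \<in> borel_measurable borel" "g \<in> borel_measurable borel"
    using f g by (auto intro: space_measurable)
  show ?thesis
    using integral_distr[of "(*) \<zeta>" \<mu> borel "\<lambda>z. f z * cnj (g z)"] bergman_measure_rotation[OF \<alpha> \<zeta>]
    by (simp add: bergman_inner_def)
qed

text \<open>Off the disc the right-hand side vanishes too, since |\<zeta> z| = |z| and f is extended
  by 0.\<close>

lemma composition_rotation:
  assumes "f \<in> A2" "norm \<zeta> = 1" "\<And>z. z \<in> unit_disc \<Longrightarrow> \<Phi> z = \<zeta> * z"
  shows "composition_operator \<Phi> f = (\<lambda>z. f (\<zeta> * z))"
  using assms by (auto simp: composition_operator_def space_iff disc_function_def norm_mult)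

text \<open>The adjoint of composition with a rotation is composition with the inverse rotation, so
  the product is composition with the single rotation by \<open>\<xi> * cnj \<zeta>\<close>.\<close>

lemma rotations_imp_isometry:
  assumes "disc_rotation \<Phi>" "disc_rotation \<Psi>"
  shows "bergman_isometry \<alpha> (bergman_adjoint \<alpha> (composition_operator \<Phi>) \<circ> composition_operator \<Psi>)"
proof -
  obtain \<zeta> \<xi> where \<zeta>: "norm \<zeta> = 1" "\<And>z. z \<in> unit_disc \<Longrightarrow> \<Phi> z = \<zeta> * z"
    and \<xi>: "norm \<xi> = 1" "\<And>z. z \<in> unit_disc \<Longrightarrow> \<Psi> z = \<xi> * z"
    using assms by (auto simp: disc_rotation_def)
  have inv: "\<zeta> * cnj \<zeta> = 1" using \<zeta>(1) by (simp add: complex_norm_square[symmetric])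
  have "(bergman_adjoint \<alpha> (composition_operator \<Phi>) \<circ> composition_operator \<Psi>) f =
      (\<lambda>z. f (\<xi> * cnj \<zeta> * z))" if f: "f \<in> A2" for f
    unfolding o_def
  proof (rule adjoint_eqI)
    show h: "(\<lambda>z. f (\<xi> * cnj \<zeta> * z)) \<in> A2" using f \<zeta> \<xi> by (intro rotation_space) (auto simp: norm_mult)
    fix k assume k: "k \<in> A2"
    have "ip (composition_operator \<Phi> k) (composition_operator \<Psi> f) =
        ip (\<lambda>z. k (\<zeta> * z)) (\<lambda>z. f (\<xi> * z))"
      using composition_rotation[OF k \<zeta>] composition_rotation[OF f \<xi>] by simp
    also have "(\<lambda>z. f (\<xi> * z)) = (\<lambda>z. f (\<xi> * cnj \<zeta> * (\<zeta> * z)))"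
    proof
      fix z
      have "\<xi> * cnj \<zeta> * (\<zeta> * z) = \<xi> * (\<zeta> * cnj \<zeta>) * z" by (simp only: mult_ac)
      then show "f (\<xi> * z) = f (\<xi> * cnj \<zeta> * (\<zeta> * z))" by (simp only: inv mult_1_right)
    qed
    also have "ip (\<lambda>z. k (\<zeta> * z)) (\<lambda>z. f (\<xi> * cnj \<zeta> * (\<zeta> * z))) = ip k (\<lambda>z. f (\<xi> * cnj \<zeta> * z))"
      using inner_rotation[OF k h \<zeta>(1)] by simp
    finally show "ip (composition_operator \<Phi> k) (composition_operator \<Psi> f) = ip k (\<lambda>z. f (\<xi> * cnj \<zeta> * z))" .
  qed
  then show ?thesis
    unfolding bergman_isometry_def using rotation_space[of _ "\<xi> * cnj \<zeta>"] \<zeta> \<xi> by (simp add: norm_mult)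
qed

lemma isometry_imp_rotations:
  assumes \<Phi>: "\<Phi> holomorphic_on unit_disc" "\<Phi> ` unit_disc \<subseteq> unit_disc"
    and \<Psi>: "\<Psi> holomorphic_on unit_disc" "\<Psi> ` unit_disc \<subseteq> unit_disc"
    and iso: "bergman_isometry \<alpha> (bergman_adjoint \<alpha> (composition_operator \<Phi>) \<circ> composition_operator \<Psi>)"
  shows "disc_rotation \<Phi>" "disc_rotation \<Psi>"
proof -
  define T where "T f = bergman_adjoint \<alpha> (composition_operator \<Phi>) (composition_operator \<Psi> f)" for f
  let ?one = "disc_monomial 0" and ?id = "disc_monomial 1"
  have nrm_T: "nrm (T f) = nrm f" if "f \<in> A2" for f
    using iso that by (simp add: bergman_isometry_def T_def)
  obtain K where C\<Psi>: "\<And>f. f \<in> A2 \<Longrightarrow> composition_operator \<Psi> f \<in> A2"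
    using composition_bounded[OF \<Psi>] by blast
  obtain K where C\<Phi>: "\<And>f. f \<in> A2 \<Longrightarrow> composition_operator \<Phi> f \<in> A2"
    using composition_bounded[OF \<Phi>] by blast
  have T: "T f \<in> A2" "\<And>k. k \<in> A2 \<Longrightarrow> ip k (T f) = ip (composition_operator \<Phi> k) (composition_operator \<Psi> f)"
    if "f \<in> A2" for f
    unfolding T_def using composition_adjoint[OF \<Phi> C\<Psi>[OF that]] by auto
  have one: "composition_operator \<Phi> ?one = ?one" "composition_operator \<Psi> ?one = ?one"
    using \<Phi>(2) \<Psi>(2) by (auto simp: composition_operator_def disc_monomial_def image_subset_iff)
  have T_one: "T ?one = ?one"
  proof (rule nrm_diff_eq_0[OF T(1) monomial_space])
    have "ip ?one (T ?one) = of_real ((nrm ?one)\<^sup>2)"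
      using T(2)[OF monomial_space monomial_space, of 0 0] by (simp add: one inner_self)
    then have "ip (T ?one) ?one = of_real ((nrm ?one)\<^sup>2)"
      by (subst inner_commute) simp
    then have "(nrm (\<lambda>z. T ?one z - ?one z))\<^sup>2 = 0"
      by (simp add: nrm_diff_square T monomial_space nrm_T del: of_real_power)
    then show "nrm (\<lambda>z. T ?one z - ?one z) = 0" by simp
  qed (rule monomial_space)
  have \<Phi>0: "\<Phi> 0 = 0"
  proof -
    \<comment> \<open>Pairing with 1 evaluates at the origin, so the right-hand side is \<Phi> 0;
      the left-hand side is 0 by orthogonality once T 1 = 1 is inserted.\<close>
    have "ip ?id (T ?one) = ip (composition_operator \<Phi> ?id) ?one"
      using T(2)[OF monomial_space monomial_space, of 1 0] by (simp add: one)
    also have "\<dots> = composition_operator \<Phi> ?id 0"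
      by (intro inner_monomial_0 C\<Phi> monomial_space)
    finally have "composition_operator \<Phi> ?id 0 = 0"
      unfolding T_one by (simp add: inner_monomial)
    moreover have "\<Phi> 0 \<in> unit_disc" using \<Phi>(2) by (auto simp: image_subset_iff)
    ultimately show ?thesis by (simp add: composition_operator_def disc_monomial_def)
  qed
  note contr = littlewood[OF \<Phi> \<Phi>0]
  have \<Psi>0: "\<Psi> 0 = 0"
  proof (rule ccontr)
    assume nz: "\<Psi> 0 \<noteq> 0"
    \<comment> \<open>These are the coefficients of f = 1 + cnj (\<Psi> 0) z. With s = |\<Psi> 0|^2,
      the value f (\<Psi> 0) is 1 + s, while the squared norm is at most 1 + s because moments are
      at most 1. Then (1 + s)^2 \<le> 1 + s forces s = 0.\<close>
    define b where "b k = (if k = 0 then 1 else cnj (\<Psi> 0))" for k :: nat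
    define f where "f = disc_polynomial b 2"
    have f: "f \<in> A2" unfolding f_def by (rule polynomial_space)
    have "\<Psi> 0 \<in> unit_disc" using \<Psi>(2) by (auto simp: image_subset_iff)
    then have "composition_operator \<Psi> f 0 = 1 + cnj (\<Psi> 0) * \<Psi> 0"
      by (simp add: composition_operator_def f_def disc_polynomial_def disc_monomial_def b_def
          numeral_2_eq_2)
    then have f0: "composition_operator \<Psi> f 0 = of_real (1 + (norm (\<Psi> 0))\<^sup>2)"
      by (simp add: complex_norm_square mult.commute del: of_real_power)
    have "ip ?one (T f) = ip ?one (composition_operator \<Psi> f)"
      using T(2)[OF f monomial_space, of 0] by (simp add: one)
    also have "\<dots> = cnj (composition_operator \<Psi> f 0)"
      by (subst inner_commute) (simp add: inner_monomial_0 C\<Psi> f)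
    finally have "norm (ip ?one (T f)) = 1 + (norm (\<Psi> 0))\<^sup>2"
      unfolding f0 by (simp only: complex_cnj_complex_of_real norm_of_real) simp
    moreover have "norm (ip ?one (T f)) \<le> nrm ?one * nrm (T f)"
      by (intro cauchy_schwarz T f monomial_space)
    ultimately have "(1 + (norm (\<Psi> 0))\<^sup>2)\<^sup>2 \<le> (nrm ?one * nrm f)\<^sup>2"
      using nrm_T[OF f] by (intro power_mono) auto
    also have "\<dots> \<le> 1 * (1 + (norm (\<Psi> 0))\<^sup>2)"
      unfolding power_mult_distrib nrm_monomial f_def nrm_polynomial
      using gam_le_1[of 0] gam_le_1[of 1] gam_pos[of 0] gam_pos[of 1]
      by (intro mult_mono) (auto simp: b_def numeral_2_eq_2 intro!: add_mono mult_left_le)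
    finally have "(norm (\<Psi> 0))\<^sup>2 + ((norm (\<Psi> 0))\<^sup>2)\<^sup>2 \<le> 0"
      by (simp add: power2_eq_square algebra_simps)
    moreover have "(norm (\<Psi> 0))\<^sup>2 > 0" using nz by simp
    ultimately show False using zero_le_power2[of "(norm (\<Psi> 0))\<^sup>2"] by linarith
  qed
  have schwarz: "norm (\<Psi> z) \<le> norm z" if "z \<in> unit_disc" for z
    using Schwarz_Lemma(1)[of \<Psi> z] \<Psi> \<Psi>0 that by (auto simp: image_subset_iff)
  have "nrm ?id \<le> nrm (composition_operator \<Psi> ?id)"
  proof (cases "nrm ?id = 0")
    case False
    \<comment> \<open>The adjoint relation is used with T z itself as the test function, so the
      squared norm of T z becomes an inner product that Cauchy-Schwarz can split.\<close>
    have "complex_of_real ((nrm ?id)\<^sup>2) = ip (composition_operator \<Phi> (T ?id)) (composition_operator \<Psi> ?id)"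
      using T(2)[OF monomial_space T(1)[OF monomial_space], of 1 1] nrm_T[OF monomial_space, of 1]
      by (simp add: inner_self)
    then have "(nrm ?id)\<^sup>2 = norm (ip (composition_operator \<Phi> (T ?id)) (composition_operator \<Psi> ?id))"
      by (metis abs_power2 norm_of_real)
    also have "\<dots> \<le> nrm (composition_operator \<Phi> (T ?id)) * nrm (composition_operator \<Psi> ?id)"
      by (intro cauchy_schwarz C\<Phi> C\<Psi> T monomial_space)
    also have "\<dots> \<le> nrm ?id * nrm (composition_operator \<Psi> ?id)"
      using contr(2)[OF T(1)[OF monomial_space], of 1] nrm_T[OF monomial_space, of 1]
      by (intro mult_right_mono nrm_nonneg) simp
    finally show ?thesis using False nrm_nonneg[of ?id] by (simp add: power2_eq_square)
  qed (simp add: nrm_nonneg)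
  then have le: "(LINT z|\<mu>. (norm (?id z))\<^sup>2) \<le> (LINT z|\<mu>. (norm (composition_operator \<Psi> ?id z))\<^sup>2)"
    unfolding nrm_square[symmetric] by (intro power_mono nrm_nonneg)
  have \<Psi>_id: "composition_operator \<Psi> ?id z = \<Psi> z" if "z \<in> unit_disc" for z
  proof -
    have "\<Psi> z \<in> unit_disc" using that \<Psi>(2) by blast
    with that show ?thesis by (simp add: composition_operator_def disc_monomial_def)
  qed
  have "\<exists>z. norm z < 1 \<and> z \<noteq> 0 \<and> norm (\<Psi> z) = norm z"
  proof (rule ccontr)
    assume "\<not> ?thesis"
    \<comment> \<open>If Schwarz' inequality were strict at every nonzero point, |z|^2 - |\<Psi>
      z|^2 would be positive on the open punctured disc and have positive integral, against
      \<open>le\<close>.\<close>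
    then have strict: "norm (\<Psi> z) < norm z" if "z \<in> unit_disc - {0}" for z
      using schwarz[of z] that by force
    have nonneg: "0 \<le> (norm (?id z))\<^sup>2 - (norm (composition_operator \<Psi> ?id z))\<^sup>2" for z
    proof (cases "z \<in> unit_disc")
      case True
      have "(norm (\<Psi> z))\<^sup>2 \<le> (norm z)\<^sup>2" by (intro power_mono schwarz True) simp
      with True show ?thesis unfolding \<Psi>_id[OF True] by (simp add: disc_monomial_def)
    qed (simp add: disc_monomial_def composition_operator_def)
    have i: "integrable \<mu> (\<lambda>z. (norm (?id z))\<^sup>2)" "integrable \<mu> (\<lambda>z. (norm (composition_operator \<Psi> ?id z))\<^sup>2)"
      using monomial_space[of 1] C\<Psi>[OF monomial_space, of 1] by (auto simp: space_iff)
    have "(1/2 :: complex) \<in> unit_disc - {0}" by simp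
    then have ne: "unit_disc - {0 :: complex} \<noteq> {}" by blast
    have "(LINT z|\<mu>. (norm (?id z))\<^sup>2 - (norm (composition_operator \<Psi> ?id z))\<^sup>2) > 0"
    proof (rule integral_pos[OF _ nonneg _ ne])
      fix z :: complex assume z: "z \<in> unit_disc - {0}"
      have "(norm (\<Psi> z))\<^sup>2 < (norm z)\<^sup>2" by (intro power_strict_mono strict z) auto
      with z show "0 < (norm (?id z))\<^sup>2 - (norm (composition_operator \<Psi> ?id z))\<^sup>2"
        using \<Psi>_id[of z] by (simp add: disc_monomial_def)
    qed (use i in \<open>auto intro: open_delete\<close>)
    with i le show False by simp
  qed
  then show rot: "disc_rotation \<Psi>" using \<Psi> \<Psi>0 by (intro disc_rotationI) auto
  then obtain \<xi> where \<xi>: "norm \<xi> = 1" "\<And>z. z \<in> unit_disc \<Longrightarrow> \<Psi> z = \<xi> * z"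
    by (auto simp: disc_rotation_def)
  \<comment> \<open>The preimage of z under composition with \<Psi>, namely cnj \<xi> z on the
    disc.\<close>
  define f where "f = (\<lambda>z. ?id (cnj \<xi> * z))"
  have f: "f \<in> A2" "nrm f = nrm ?id"
    unfolding f_def using rotation_space[OF monomial_space, of "cnj \<xi>" 1] \<xi>(1) by simp_all
  have "cnj \<xi> * \<xi> = 1" using \<xi>(1) complex_norm_square[of \<xi>] by (simp add: mult.commute)
  then have f\<Psi>: "composition_operator \<Psi> f = ?id"
    by (subst composition_rotation[OF f(1) \<xi>]) (simp_all add: f_def mult.assoc[symmetric])
  define g where "g = T f"
  have g: "g \<in> A2" "nrm g = nrm ?id" unfolding g_def using T[OF f(1)] nrm_T[OF f(1)] f(2) by auto
  \<comment> \<open>The pairing is the inner product of g with T f = g. Together with the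
    contraction bound this leaves no room for a nonzero difference between the composed g and
    z.\<close>
  have "ip (composition_operator \<Phi> g) ?id = of_real ((nrm ?id)\<^sup>2)"
    using T(2)[OF f(1) g(1)] g(2) by (simp add: f\<Psi> g_def[symmetric] inner_self)
  then have "(nrm (\<lambda>z. composition_operator \<Phi> g z - ?id z))\<^sup>2 =
      (nrm (composition_operator \<Phi> g))\<^sup>2 - (nrm ?id)\<^sup>2"
    by (simp add: nrm_diff_square C\<Phi> g monomial_space del: of_real_power)
  also have "\<dots> \<le> 0"
    using power_mono[OF contr(2)[OF g(1)] nrm_nonneg, of 2] g(2) by simp
  finally have "nrm (\<lambda>z. composition_operator \<Phi> g z - ?id z) = 0" by simp
  then have g\<Phi>: "composition_operator \<Phi> g = ?id"
    by (intro nrm_diff_eq_0 C\<Phi> g monomial_space)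
  have dg: "disc_function g" using g by (simp add: space_iff)
  define b where "b = (\<lambda>k. (deriv ^^ k) g 0 / fact k)"
  have b: "disc_expansion g b" unfolding b_def by (rule disc_function_expansion[OF dg])
  have g1: "norm (deriv g 0) \<le> 1"
  proof -
    \<comment> \<open>The coefficient of index 1 is g' 0, so Cauchy-Schwarz against z bounds it;
      both norms squared equal \<open>gam 1\<close>.\<close>
    have "norm (deriv g 0) * gam 1 = norm (ip g ?id)"
      using inner_monomial_expansion[OF g(1) b, of 1] gam_pos[of 1] by (simp add: b_def norm_mult)
    also have "\<dots> \<le> nrm g * nrm ?id" by (intro cauchy_schwarz g monomial_space)
    also have "\<dots> = gam 1" using g(2) nrm_monomial[of 1] by (simp add: power2_eq_square)
    finally show ?thesis using gam_pos[of 1] by simp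
  qed
  have chain: "deriv g 0 * deriv \<Phi> 0 = 1"
  proof -
    \<comment> \<open>The identity g (\<Phi> z) = z is differentiated at 0, where \<Phi> 0 = 0 puts
      the outer derivative at 0 as well.\<close>
    have "(\<Phi> has_field_derivative deriv \<Phi> 0) (at 0)"
      using \<Phi>(1) by (intro holomorphic_derivI[of _ unit_disc]) auto
    moreover have "(g has_field_derivative deriv g 0) (at (\<Phi> 0))"
      unfolding \<Phi>0 using dg by (intro holomorphic_derivI[of _ unit_disc]) (auto simp: disc_function_def)
    ultimately have "((\<lambda>z. g (\<Phi> z)) has_field_derivative deriv g 0 * deriv \<Phi> 0) (at 0)"
      by (rule DERIV_chain2[rotated])
    moreover have "((\<lambda>z. g (\<Phi> z)) has_field_derivative 1) (at 0)"
    proof (rule has_field_derivative_transform_within_open[of "\<lambda>z. z" 1 0 unit_disc])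
      fix z assume "z \<in> unit_disc"
      then show "z = g (\<Phi> z)"
        using fun_cong[OF g\<Phi>, of z] by (simp add: composition_operator_def disc_monomial_def)
    qed auto
    ultimately show ?thesis by (rule DERIV_unique)
  qed
  have "norm (deriv \<Phi> 0) \<le> 1"
    using Schwarz_Lemma(2)[of \<Phi> 0] \<Phi> \<Phi>0 by (auto simp: image_subset_iff)
  moreover have "1 \<le> norm (deriv \<Phi> 0)"
  proof -
    have "1 = norm (deriv g 0) * norm (deriv \<Phi> 0)" using chain by (metis norm_mult norm_one)
    also have "\<dots> \<le> 1 * norm (deriv \<Phi> 0)" using g1 by (intro mult_right_mono) auto
    finally show ?thesis by simp
  qed
  ultimately show "disc_rotation \<Phi>" using \<Phi> \<Phi>0 by (intro disc_rotationI) auto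
qed

end

theorem theorem3p4:
  fixes \<alpha> :: real and \<Phi> \<Psi> :: "complex \<Rightarrow> complex"
  assumes "\<alpha> > -1"
    and "\<Phi> holomorphic_on unit_disc" and "\<Phi> ` unit_disc \<subseteq> unit_disc"
    and "\<Psi> holomorphic_on unit_disc" and "\<Psi> ` unit_disc \<subseteq> unit_disc"
  shows "bergman_isometry \<alpha> (bergman_adjoint \<alpha> (composition_operator \<Phi>) \<circ> composition_operator \<Psi>)
     \<longleftrightarrow> disc_rotation \<Phi> \<and> disc_rotation \<Psi>"
proof -
  interpret weighted_bergman \<alpha> by unfold_locales fact
  show ?thesis
    using isometry_imp_rotations[OF assms(2-5)] rotations_imp_isometry by blast
qed

end
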